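(* Let $X$ be a set, $\Omega$ a nonempty set, and $(\lambda_\omega)_{\omega\in\Omega}$ a collection of elements of $\mathbf{k}$. With respect to the monomial order $\leq_{\mathrm{db}}$ on $\mathfrak{M}(\Omega,X)$: (a) the set $$\mathbb{S}_M=\Big\{\lfloor u\rfloor_\alpha\lfloor v\rfloor_\beta-\big\lfloor\lfloor u\rfloor_\alpha v\big\rfloor_\beta-\big\lfloor u\lfloor v\rfloor_\beta\big\rfloor_\alpha-\lambda_\beta\lfloor uv\rfloor_\alpha\ \Big|\ u,v\in\mathfrak{M}(\Omega,X),\ \alpha,\beta\in\Omega\Big\}$$ is a Gröbner-Shirshov basis in $\mathbf{k}\mathfrak{M}(\Omega,X)$; (b) the set $$\mathrm{Irr}(\mathbb{S}_M)=\{w\in\mathfrak{M}(\Omega,X)\mid w\neq q|_{\overline{s}}\text{ for any }q\in\mathfrak{M}^\star(\Omega,X)\text{ and any }s\in\mathbb{S}_M\}$$ is a $\mathbf{k}$-basis of the free matching Rota-Baxter algebra $\mathbf{k}\mathfrak{M}(\Omega,X)/\mathrm{Id}(\mathbb{S}_M)$ (of weight $(\lambda_\omega)_{\omega\in\Omega}$) on $X$.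
   Context: $\mathbf{k}$ is a fixed commutative unitary ring; algebras are unitary associative $\mathbf{k}$-algebras. **Matching Rota-Baxter algebra of weight $(\lambda_\omega)_{\omega\in\Omega}$.** An algebra $A$ with linear operators $R_\omega:A\to A$ ($\omega\in\Omega$) such that for all $a,b\in A$, $\alpha,\beta\in\Omega$: $R_\alpha(a)R_\beta(b)=R_\beta(R_\alpha(a)b)+R_\alpha(aR_\beta(b))+\lambda_\beta R_\alpha(ab)$. **Bracketed words.** Let $M(Y)$ be the free monoid on $Y$ and, for $\omega\in\Omega$, let $\lfloor Y\rfloor_\omega=\{\lfloor y\rfloor_\omega\mid y\in Y\}$ be a disjoint copy of $Y$ (disjoint for different $\omega$). Set $\mathfrak{M}_0=M(X)$, $\mathfrak{M}_n=M(X\sqcup\bigsqcup_{\omega\in\Omega}\lfloor\mathfrak{M}_{n-1}\rfloor_\omega)$, with the natural inclusions $\mathfrak{M}_{n-1}\hookrightarrow\mathfrak{M}_n$, and $\mathfrak{M}(\Omega,X)=\bigcup_n\mathfrak{M}_n$, a monoid with identity $1$. $\mathbf{k}\mathfrak{M}(\Omega,X)$ is the free module on it, with multiplication extended linearly and linear operators $w\mapsto\lfloor w\rfloor_\omega$; it is the free algebra on $X$ equipped with a family of linear operators indexed by $\Omega$. Elements of $X\sqcup\bigsqcup_\omega\lfloor\mathfrak{M}(\Omega,X)\rfloor_\omega$ are called prime; if $u=u_1\cdots u_n$ with $u_i$ prime, the breadth is $|u|=n$ (and $|1|=0$). $\mathfrak{M}^\star(\Omega,X)$ is the set of words in $\mathfrak{M}(\Omega,X\sqcup\{\star\})$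 in which $\star$ occurs exactly once; $q|_u$ is obtained from $q$ by replacing $\star$ by $u$, extended linearly in $u$. $\mathrm{Id}(\mathbb{S})$ is the two-sided ideal, closed under all operators $\lfloor\,\rfloor_\omega$, generated by $\mathbb{S}$. In the quotient, $R_\omega$ is the operator induced by $\lfloor\,\rfloor_\omega$. **The order $\leq_{\mathrm{db}}$.** Fix well orders $\leq_X$ on $X$ and $\leq_\Omega$ on the set of operators $\{\lfloor\,\rfloor_\omega\mid\omega\in\Omega\}$. Let $\deg(u)$ be the total number of occurrences in $u$ of letters of $X$ and of operators, counted with multiplicity. For $u=u_1\cdots u_m$, $v=v_1\cdots v_n$ with prime factors $u_i,v_j$, $u\leq_{\mathrm{db}}v$ is defined recursively by lexicographic comparison of $(\deg(u),|u|,u_1,\dots,u_m)$ and $(\deg(v),|v|,v_1,\dots,v_n)$, i.e. first by degree, then by breadth, then by prime factors lexicographically; two prime elements of equal degree are compared as follows: elements of $X$ by $\leq_X$; an element of $X$ is smaller than any bracket; two brackets $\lfloor\tilde u\rfloor_\alpha,\lfloor\tilde v\rfloor_\beta$ by lexicographic comparison of $(\lfloor\,\rfloor_\alpha,\tilde u)$ and $(\lfloor\,\rfloor_\beta,\tilde v)$, using $\leq_\Omega$ and then $\leq_{\mathrm{db}}$. **Gröbner-Shirshov basis.** A monomial order is a well order $\leq$ on $\mathfrak{M}(\Omega,X)$ such that $u<v$ implies $q|_u<q|_v$ for all $q\in\mathfrak{M}^\star(\Omega,X)$. Given one, $\overline{f}$ denotes the leading monomial of $f\neq0$; $f$ is monic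 if its leading coefficient is $1$. Let $f,g$ be distinct monic elements. If $w=\overline{f}u=v\overline{g}$ for words $u,v,w$ with $\max\{|\overline f|,|\overline g|\}<|w|<|\overline f|+|\overline g|$, then $fu-vg$ is an intersection composition of $f,g$ with ambiguity $w$. If $w=\overline f=q|_{\overline g}$ with $q\in\mathfrak{M}^\star(\Omega,X)$, then $f-q|_g$ is an including composition with ambiguity $w$. For a set $\mathbb{S}$ of monic elements, a composition $h$ with ambiguity $w$ is trivial modulo $(\mathbb{S},w)$ if $h=\sum_ic_iq_i|_{s_i}$ (finite sum) with $c_i\in\mathbf{k}\setminus\{0\}$, $q_i\in\mathfrak{M}^\star(\Omega,X)$, $s_i\in\mathbb{S}$, $q_i|_{\overline{s_i}}<w$. $\mathbb{S}$ is a Gröbner-Shirshov basis if all intersection and including compositions of all pairs $f,g\in\mathbb{S}$ are trivial modulo $(\mathbb{S},w)$. *)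

theory Defs
  imports "HOL-Algebra.QuotRing" "HOL-Algebra.Module" "HOL-Library.Poly_Mapping"
begin

section \<open>Bracketed words\<close>

datatype ('w, 'x) prime_word = Letter 'x | Bracket 'w "('w, 'x) prime_word list"

type_synonym ('w, 'x) word = "('w, 'x) prime_word list"

text \<open>
  Since all stages live in one datatype, the natural inclusions of each stage into the next are
  literal inclusions of sets. The breadth of a word is its length.
\<close>

primrec bwords_upto :: "'w set \<Rightarrow> 'x set \<Rightarrow> nat \<Rightarrow> ('w, 'x) word set" where
  "bwords_upto \<Omega> X 0 = lists (Letter ` X)"
| "bwords_upto \<Omega> X (Suc n) = lists (Letter ` X \<union> (\<Union>\<omega>\<in>\<Omega>. Bracket \<omega> ` bwords_upto \<Omega> X n))"

definition bwords :: "'w set \<Rightarrow> 'x set \<Rightarrow> ('w, 'x) word set" where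
  "bwords \<Omega> X = (\<Union>n. bwords_upto \<Omega> X n)"

text \<open>
  The extra letter \<open>\<star>\<close> is represented by \<open>None\<close>, a letter \<open>x\<close> of \<open>X\<close> by \<open>Some x\<close>.
\<close>

fun star_count_prime :: "('w, 'x option) prime_word \<Rightarrow> nat" where
  "star_count_prime (Letter None) = 1"
| "star_count_prime (Letter (Some x)) = 0"
| "star_count_prime (Bracket \<omega> w) = sum_list (map star_count_prime w)"

definition star_count :: "('w, 'x option) word \<Rightarrow> nat" where
  "star_count q = sum_list (map star_count_prime q)"

definition star_words :: "'w set \<Rightarrow> 'x set \<Rightarrow> ('w, 'x option) word set" where
  "star_words \<Omega> X = {q \<in> bwords \<Omega> (insert None (Some ` X)). star_count q = 1}"

text \<open>\<open>subst_word u q\<close> is \<open>q|\<^sub>u\<close>.\<close>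

fun subst_prime :: "('w, 'x) word \<Rightarrow> ('w, 'x option) prime_word \<Rightarrow> ('w, 'x) word" where
  "subst_prime u (Letter None) = u"
| "subst_prime u (Letter (Some x)) = [Letter x]"
| "subst_prime u (Bracket \<omega> w) = [Bracket \<omega> (concat (map (subst_prime u) w))]"

definition subst_word :: "('w, 'x) word \<Rightarrow> ('w, 'x option) word \<Rightarrow> ('w, 'x) word" where
  "subst_word u q = concat (map (subst_prime u) q)"


section \<open>The free operated algebra on bracketed words\<close>

text \<open>
  The free monoid, written additively so that \<^typ>\<open>'a list \<Rightarrow>\<^sub>0 'k\<close> is the monoid algebra with
  the convolution product of \<^theory>\<open>HOL-Library.Poly_Mapping\<close>.
\<close>

instantiation list :: (type) monoid_add
begin

definition zero_list :: "'a list" where "zero_list = []"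

definition plus_list :: "'a list \<Rightarrow> 'a list \<Rightarrow> 'a list" where "plus_list = (@)"

instance
  by standard (simp_all add: zero_list_def plus_list_def)

end

type_synonym ('w, 'x, 'k) bpoly = "('w, 'x) word \<Rightarrow>\<^sub>0 'k"

abbreviation mono_elt :: "('w, 'x) word \<Rightarrow> ('w, 'x, 'k::comm_ring_1) bpoly" where
  "mono_elt w \<equiv> Poly_Mapping.single w 1"

abbreviation scale :: "'k \<Rightarrow> ('w, 'x, 'k::comm_ring_1) bpoly \<Rightarrow> ('w, 'x, 'k) bpoly" where
  "scale c \<equiv> Poly_Mapping.map ((*) c)"

definition lin_ext ::
    "('a \<Rightarrow> ('w, 'x) word) \<Rightarrow> ('a \<Rightarrow>\<^sub>0 'k) \<Rightarrow> ('w, 'x, 'k::comm_ring_1) bpoly" where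
  "lin_ext h f = (\<Sum>w \<in> Poly_Mapping.keys f. Poly_Mapping.single (h w) (Poly_Mapping.lookup f w))"

definition bracket_lin ::
    "'w \<Rightarrow> ('w, 'x, 'k::comm_ring_1) bpoly \<Rightarrow> ('w, 'x, 'k) bpoly" where
  "bracket_lin \<omega> = lin_ext (\<lambda>w. [Bracket \<omega> w])"

definition subst_lin ::
    "('w, 'x, 'k::comm_ring_1) bpoly \<Rightarrow> ('w, 'x option) word \<Rightarrow> ('w, 'x, 'k) bpoly" where
  "subst_lin f q = lin_ext (\<lambda>w. subst_word w q) f"

definition bpolys :: "'w set \<Rightarrow> 'x set \<Rightarrow> ('w, 'x, 'k::comm_ring_1) bpoly set" where
  "bpolys \<Omega> X = {f. Poly_Mapping.keys f \<subseteq> bwords \<Omega> X}"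

record ('k, 'a, 'w) operated_alg = "('k, 'a) module" +
  oper :: "'w \<Rightarrow> 'a \<Rightarrow> 'a"

definition bword_alg ::
    "'w set \<Rightarrow> 'x set \<Rightarrow> ('k::comm_ring_1, ('w, 'x, 'k) bpoly, 'w) operated_alg" where
  "bword_alg \<Omega> X =
    \<lparr>carrier = bpolys \<Omega> X, monoid.mult = (*), one = 1, zero = 0, add = (+),
     smult = scale, oper = bracket_lin\<rparr>"


section \<open>Operated algebras, ideals, quotients and bases\<close>

definition coeff_ring :: "'k::comm_ring_1 ring" where
  "coeff_ring = \<lparr>carrier = UNIV, monoid.mult = (*), one = 1, zero = 0, add = (+)\<rparr>"

definition operated_algebra ::
    "'w set \<Rightarrow> ('k::comm_ring_1, 'a, 'w) operated_alg \<Rightarrow> bool" where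
  "operated_algebra \<Omega> A \<longleftrightarrow>
    ring A \<and> module (coeff_ring :: 'k ring) A \<and>
    (\<forall>c. \<forall>a\<in>carrier A. \<forall>b\<in>carrier A.
      (c \<odot>\<^bsub>A\<^esub> a) \<otimes>\<^bsub>A\<^esub> b = c \<odot>\<^bsub>A\<^esub> (a \<otimes>\<^bsub>A\<^esub> b) \<and>
      a \<otimes>\<^bsub>A\<^esub> (c \<odot>\<^bsub>A\<^esub> b) = c \<odot>\<^bsub>A\<^esub> (a \<otimes>\<^bsub>A\<^esub> b)) \<and>
    (\<forall>\<omega>\<in>\<Omega>. oper A \<omega> \<in> carrier A \<rightarrow> carrier A \<and>
      (\<forall>a\<in>carrier A. \<forall>b\<in>carrier A.
        oper A \<omega> (a \<oplus>\<^bsub>A\<^esub> b) = oper A \<omega> a \<oplus>\<^bsub>A\<^esub> oper A \<omega> b) \<and>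
      (\<forall>c. \<forall>a\<in>carrier A. oper A \<omega> (c \<odot>\<^bsub>A\<^esub> a) = c \<odot>\<^bsub>A\<^esub> oper A \<omega> a))"

definition operated_hom ::
    "'w set \<Rightarrow> ('k::comm_ring_1, 'a, 'w) operated_alg \<Rightarrow> ('k, 'b, 'w) operated_alg \<Rightarrow>
      ('a \<Rightarrow> 'b) set" where
  "operated_hom \<Omega> A B = {\<phi> \<in> ring_hom A B.
    (\<forall>c. \<forall>a\<in>carrier A. \<phi> (c \<odot>\<^bsub>A\<^esub> a) = c \<odot>\<^bsub>B\<^esub> \<phi> a) \<and>
    (\<forall>\<omega>\<in>\<Omega>. \<forall>a\<in>carrier A. \<phi> (oper A \<omega> a) = oper B \<omega> (\<phi> a))}"

text \<open>
  A two-sided ideal of a unital algebra is automatically closed under scalars.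
\<close>

definition operated_ideal ::
    "'w set \<Rightarrow> ('k::comm_ring_1, 'a, 'w) operated_alg \<Rightarrow> 'a set \<Rightarrow> bool" where
  "operated_ideal \<Omega> A I \<longleftrightarrow> ideal I A \<and> (\<forall>\<omega>\<in>\<Omega>. \<forall>a\<in>I. oper A \<omega> a \<in> I)"

definition gen_operated_ideal ::
    "'w set \<Rightarrow> ('k::comm_ring_1, 'a, 'w) operated_alg \<Rightarrow> 'a set \<Rightarrow> 'a set" where
  "gen_operated_ideal \<Omega> A S = \<Inter>{I. operated_ideal \<Omega> A I \<and> S \<subseteq> I}"

text \<open>
  The ring structure is that of the library's \<^const>\<open>FactRing\<close>; scalar action and operators on
  cosets are the induced ones, in the same style as \<^const>\<open>rcoset_mult\<close>.
\<close>

definition quot_alg ::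
    "('k::comm_ring_1, 'a, 'w) operated_alg \<Rightarrow> 'a set \<Rightarrow> ('k, 'a set, 'w) operated_alg" where
  "quot_alg A I =
    \<lparr>carrier = carrier (A Quot I), monoid.mult = monoid.mult (A Quot I), one = one (A Quot I),
     zero = zero (A Quot I), add = add (A Quot I),
     smult = (\<lambda>c C. \<Union>a\<in>C. I +>\<^bsub>A\<^esub> (c \<odot>\<^bsub>A\<^esub> a)),
     oper = (\<lambda>\<omega> C. \<Union>a\<in>C. I +>\<^bsub>A\<^esub> oper A \<omega> a)\<rparr>"

text \<open>
  Bases are indexed families, so that being a basis includes that distinct indices give distinct
  elements.
\<close>

definition basis_family ::
    "('k::comm_ring_1, 'a, 'm) module_scheme \<Rightarrow> 'i set \<Rightarrow> ('i \<Rightarrow> 'a) \<Rightarrow> bool" where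
  "basis_family M J b \<longleftrightarrow>
    b \<in> J \<rightarrow> carrier M \<and>
    (\<forall>F c. finite F \<longrightarrow> F \<subseteq> J \<longrightarrow> (\<Oplus>\<^bsub>M\<^esub>j\<in>F. c j \<odot>\<^bsub>M\<^esub> b j) = \<zero>\<^bsub>M\<^esub> \<longrightarrow> (\<forall>j\<in>F. c j = 0)) \<and>
    (\<forall>a\<in>carrier M. \<exists>F c. finite F \<and> F \<subseteq> J \<and> a = (\<Oplus>\<^bsub>M\<^esub>j\<in>F. c j \<odot>\<^bsub>M\<^esub> b j))"


section \<open>Matching Rota-Baxter algebras\<close>

definition matching_rota_baxter ::
    "'w set \<Rightarrow> ('w \<Rightarrow> 'k) \<Rightarrow> ('k::comm_ring_1, 'a, 'w) operated_alg \<Rightarrow> bool" where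
  "matching_rota_baxter \<Omega> lam A \<longleftrightarrow>
    operated_algebra \<Omega> A \<and>
    (\<forall>\<alpha>\<in>\<Omega>. \<forall>\<beta>\<in>\<Omega>. \<forall>a\<in>carrier A. \<forall>b\<in>carrier A.
      oper A \<alpha> a \<otimes>\<^bsub>A\<^esub> oper A \<beta> b =
        oper A \<beta> (oper A \<alpha> a \<otimes>\<^bsub>A\<^esub> b) \<oplus>\<^bsub>A\<^esub> oper A \<alpha> (a \<otimes>\<^bsub>A\<^esub> oper A \<beta> b)
          \<oplus>\<^bsub>A\<^esub> (lam \<beta> \<odot>\<^bsub>A\<^esub> oper A \<alpha> (a \<otimes>\<^bsub>A\<^esub> b)))"

text \<open>
  Freeness over \<open>X\<close> along \<open>i\<close>. HOL cannot quantify over the type of the test algebra inside a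
  formula, hence the type argument; a theorem that is polymorphic in it covers all test algebras.
\<close>

definition free_matching_rota_baxter ::
    "'b itself \<Rightarrow> 'w set \<Rightarrow> ('w \<Rightarrow> 'k) \<Rightarrow> 'x set \<Rightarrow>
      ('k::comm_ring_1, 'a, 'w) operated_alg \<Rightarrow> ('x \<Rightarrow> 'a) \<Rightarrow> bool" where
  "free_matching_rota_baxter (_ :: 'b itself) \<Omega> lam X A i \<longleftrightarrow>
    matching_rota_baxter \<Omega> lam A \<and> i \<in> X \<rightarrow> carrier A \<and>
    (\<forall>(B :: ('k, 'b, 'w) operated_alg) f.
      matching_rota_baxter \<Omega> lam B \<longrightarrow> f \<in> X \<rightarrow> carrier B \<longrightarrow>
      (\<exists>!\<phi>. \<phi> \<in> extensional (carrier A) \<and> \<phi> \<in> operated_hom \<Omega> A B \<and> (\<forall>x\<in>X. \<phi> (i x) = f x)))"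


section \<open>The order\<close>

fun deg_prime :: "('w, 'x) prime_word \<Rightarrow> nat" where
  "deg_prime (Letter x) = 1"
| "deg_prime (Bracket \<omega> w) = Suc (sum_list (map deg_prime w))"

definition deg_word :: "('w, 'x) word \<Rightarrow> nat" where
  "deg_word w = sum_list (map deg_prime w)"

text \<open>
  The strict part of the order. In \<open>db_factor\<close> the two words have equal breadth and \<open>a\<close>, \<open>b\<close> are
  the first prime factors at which they differ. As prime elements have breadth 1, comparing
  them as words means comparing degrees first.
\<close>

inductive db_less :: "'w rel \<Rightarrow> 'x rel \<Rightarrow> ('w, 'x) word \<Rightarrow> ('w, 'x) word \<Rightarrow> bool"
  and db_prime_less ::
    "'w rel \<Rightarrow> 'x rel \<Rightarrow> ('w, 'x) prime_word \<Rightarrow> ('w, 'x) prime_word \<Rightarrow> bool"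
  for rO :: "'w rel" and rX :: "'x rel" where
  db_deg: "deg_word u < deg_word v \<Longrightarrow> db_less rO rX u v"
| db_breadth: "deg_word u = deg_word v \<Longrightarrow> length u < length v \<Longrightarrow> db_less rO rX u v"
| db_factor: "deg_word (p @ a # s) = deg_word (p @ b # t) \<Longrightarrow> length s = length t \<Longrightarrow>
    db_prime_less rO rX a b \<Longrightarrow> db_less rO rX (p @ a # s) (p @ b # t)"
| db_prime_deg: "deg_prime a < deg_prime b \<Longrightarrow> db_prime_less rO rX a b"
| db_letters: "(x, y) \<in> rX \<Longrightarrow> x \<noteq> y \<Longrightarrow> db_prime_less rO rX (Letter x) (Letter y)"
| db_letter_bracket: "deg_prime (Letter x :: ('w, 'x) prime_word) = deg_prime (Bracket \<omega> w) \<Longrightarrow>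
    db_prime_less rO rX (Letter x) (Bracket \<omega> w)"
| db_operators: "deg_prime (Bracket \<alpha> u) = deg_prime (Bracket \<beta> v) \<Longrightarrow> (\<alpha>, \<beta>) \<in> rO \<Longrightarrow> \<alpha> \<noteq> \<beta> \<Longrightarrow>
    db_prime_less rO rX (Bracket \<alpha> u) (Bracket \<beta> v)"
| db_arguments: "deg_prime (Bracket \<alpha> u) = deg_prime (Bracket \<alpha> v) \<Longrightarrow> db_less rO rX u v \<Longrightarrow>
    db_prime_less rO rX (Bracket \<alpha> u) (Bracket \<alpha> v)"

definition db_order :: "'w set \<Rightarrow> 'x set \<Rightarrow> 'w rel \<Rightarrow> 'x rel \<Rightarrow> ('w, 'x) word rel" where
  "db_order \<Omega> X rO rX =
    {(u, v). u \<in> bwords \<Omega> X \<and> v \<in> bwords \<Omega> X \<and> (u = v \<or> db_less rO rX u v)}"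


section \<open>Groebner-Shirshov bases\<close>

abbreviation less_in :: "'a rel \<Rightarrow> 'a \<Rightarrow> 'a \<Rightarrow> bool" where
  "less_in ord u v \<equiv> (u, v) \<in> ord \<and> u \<noteq> v"

definition monomial_order :: "'w set \<Rightarrow> 'x set \<Rightarrow> ('w, 'x) word rel \<Rightarrow> bool" where
  "monomial_order \<Omega> X ord \<longleftrightarrow>
    well_order_on (bwords \<Omega> X) ord \<and>
    (\<forall>u v. less_in ord u v \<longrightarrow>
      (\<forall>q\<in>star_words \<Omega> X. less_in ord (subst_word u q) (subst_word v q)))"

definition lead_mon :: "('w, 'x) word rel \<Rightarrow> ('w, 'x, 'k::comm_ring_1) bpoly \<Rightarrow> ('w, 'x) word" where
  "lead_mon ord f =
    (THE w. w \<in> Poly_Mapping.keys f \<and> (\<forall>v \<in> Poly_Mapping.keys f. (v, w) \<in> ord))"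

definition monic :: "('w, 'x) word rel \<Rightarrow> ('w, 'x, 'k::comm_ring_1) bpoly \<Rightarrow> bool" where
  "monic ord f \<longleftrightarrow> f \<noteq> 0 \<and> Poly_Mapping.lookup f (lead_mon ord f) = 1"

definition intersection_composition ::
    "'w set \<Rightarrow> 'x set \<Rightarrow> ('w, 'x) word rel \<Rightarrow> ('w, 'x, 'k::comm_ring_1) bpoly \<Rightarrow>
      ('w, 'x, 'k) bpoly \<Rightarrow> ('w, 'x) word \<Rightarrow> ('w, 'x, 'k) bpoly \<Rightarrow> bool" where
  "intersection_composition \<Omega> X ord f g w h \<longleftrightarrow>
    (\<exists>u\<in>bwords \<Omega> X. \<exists>v\<in>bwords \<Omega> X.
      w = lead_mon ord f @ u \<and> w = v @ lead_mon ord g \<and>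
      max (length (lead_mon ord f)) (length (lead_mon ord g)) < length w \<and>
      length w < length (lead_mon ord f) + length (lead_mon ord g) \<and>
      h = f * mono_elt u - mono_elt v * g)"

definition including_composition ::
    "'w set \<Rightarrow> 'x set \<Rightarrow> ('w, 'x) word rel \<Rightarrow> ('w, 'x, 'k::comm_ring_1) bpoly \<Rightarrow>
      ('w, 'x, 'k) bpoly \<Rightarrow> ('w, 'x) word \<Rightarrow> ('w, 'x, 'k) bpoly \<Rightarrow> bool" where
  "including_composition \<Omega> X ord f g w h \<longleftrightarrow>
    (\<exists>q\<in>star_words \<Omega> X.
      w = lead_mon ord f \<and> w = subst_word (lead_mon ord g) q \<and> h = f - subst_lin g q)"

definition trivial_modulo ::
    "'w set \<Rightarrow> 'x set \<Rightarrow> ('w, 'x) word rel \<Rightarrow> ('w, 'x, 'k::comm_ring_1) bpoly set \<Rightarrow>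
      ('w, 'x) word \<Rightarrow> ('w, 'x, 'k) bpoly \<Rightarrow> bool" where
  "trivial_modulo \<Omega> X ord S w h \<longleftrightarrow>
    (\<exists>ts. h = (\<Sum>(c, q, s)\<leftarrow>ts. scale c (subst_lin s q)) \<and>
      (\<forall>(c, q, s)\<in>set ts. c \<noteq> 0 \<and> q \<in> star_words \<Omega> X \<and> s \<in> S \<and>
        less_in ord (subst_word (lead_mon ord s) q) w))"

definition groebner_shirshov_basis ::
    "'w set \<Rightarrow> 'x set \<Rightarrow> ('w, 'x) word rel \<Rightarrow> ('w, 'x, 'k::comm_ring_1) bpoly set \<Rightarrow> bool" where
  "groebner_shirshov_basis \<Omega> X ord S \<longleftrightarrow>
    S \<subseteq> bpolys \<Omega> X \<and> (\<forall>s\<in>S. monic ord s) \<and>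
    (\<forall>f\<in>S. \<forall>g\<in>S. f \<noteq> g \<longrightarrow>
      (\<forall>w h. intersection_composition \<Omega> X ord f g w h \<or> including_composition \<Omega> X ord f g w h \<longrightarrow>
        trivial_modulo \<Omega> X ord S w h))"

definition irr ::
    "'w set \<Rightarrow> 'x set \<Rightarrow> ('w, 'x) word rel \<Rightarrow> ('w, 'x, 'k::comm_ring_1) bpoly set \<Rightarrow>
      ('w, 'x) word set" where
  "irr \<Omega> X ord S =
    {w \<in> bwords \<Omega> X. \<forall>q\<in>star_words \<Omega> X. \<forall>s\<in>S. w \<noteq> subst_word (lead_mon ord s) q}"

definition S_M :: "'w set \<Rightarrow> 'x set \<Rightarrow> ('w \<Rightarrow> 'k) \<Rightarrow> ('w, 'x, 'k::comm_ring_1) bpoly set" where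
  "S_M \<Omega> X lam =
    {mono_elt [Bracket \<alpha> u, Bracket \<beta> v]
      - mono_elt [Bracket \<beta> (Bracket \<alpha> u # v)]
      - mono_elt [Bracket \<alpha> (u @ [Bracket \<beta> v])]
      - scale (lam \<beta>) (mono_elt [Bracket \<alpha> (u @ v)]) | u v \<alpha> \<beta>.
      u \<in> bwords \<Omega> X \<and> v \<in> bwords \<Omega> X \<and> \<alpha> \<in> \<Omega> \<and> \<beta> \<in> \<Omega>}"

end

theory Submission
  imports Defs
begin

text \<open>The obstacle to linear independence is that membership in the ideal cannot be refuted by
  looking at generators. A concrete algebra satisfying the relation, in which irreducible words
  remain distinct basis vectors, refutes it. The recursion for \<diamond> is the relation read as a
  rewriting rule at the only place where concatenating two irreducible words can create something
  reducible: the last factor of the left word against the first factor of the right one. Its one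
  hard property is associativity. For three brackets this is the overlap of the intersection
  compositions again, with congruence replaced by equality and degree as the induction measure. On
  the side of the order, degree and breadth alone settle the leading monomials and the intersection
  compositions; compatibility with contexts enters when a relation sits inside a bracket of another
  one.\<close>

text \<open>
  For the Groebner-Shirshov property, the relation \<open>rb_rel\<close> is bilinear in its two arguments, so each
  composition is a combination of instances of the relation by a ring identity, and it remains to
  compare leading words.

  The basis statement does not go through the composition-diamond lemma. Multiplying words with
  \<open>\<lfloor>a\<rfloor>\<^sub>\<alpha> \<diamond> \<lfloor>b\<rfloor>\<^sub>\<beta> = \<lfloor>\<lfloor>a\<rfloor>\<^sub>\<alpha> \<diamond> b\<rfloor>\<^sub>\<beta> + \<lfloor>a \<diamond> \<lfloor>b\<rfloor>\<^sub>\<beta>\<rfloor>\<^sub>\<alpha> + \<lambda>\<^sub>\<beta> \<lfloor>a \<diamond> b\<rfloor>\<^sub>\<alpha>\<close> at the junction makes the whole module of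
  bracketed polynomials a matching Rota-Baxter algebra. The operated homomorphism into it that fixes
  the letters therefore kills the ideal, and it fixes every irreducible word: these words are linearly
  independent in the quotient. They span because the product of two words is congruent to their
  \<open>\<diamond>\<close>-product, which is a combination of irreducible words when both factors are irreducible.
\<close>

section \<open>Words and contexts\<close>

lemma deg_word_simps [simp]:
  "deg_word [] = 0"
  "deg_word (p # w) = deg_prime p + deg_word w"
  "deg_word (u @ v) = deg_word u + deg_word v"
  by (simp_all add: deg_word_def)

lemma deg_prime_Bracket [simp]: "deg_prime (Bracket \<omega> w) = Suc (deg_word w)"
  by (simp add: deg_word_def)

declare deg_prime.simps(2) [simp del]

lemma deg_prime_pos [simp]: "0 < deg_prime p" "deg_prime p \<noteq> 0"
  by (cases p; simp)+

text \<open>The argument of a leading bracket and the remaining word both have smaller degree than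
  the whole word, so one induction on degree descends into brackets and along the list at the same
  time.\<close>

lemma word_induct [case_names Nil Letter Bracket]:
  assumes "P []"
    and "\<And>x w. P w \<Longrightarrow> P (Letter x # w)"
    and "\<And>\<omega> u w. P u \<Longrightarrow> P w \<Longrightarrow> P (Bracket \<omega> u # w)"
  shows "P w"
proof (induction w rule: measure_induct_rule[of deg_word])
  case (less w)
  show ?case
  proof (cases w)
    case (Cons p v)
    with less have "P v"
      by simp
    show ?thesis
    proof (cases p)
      case (Letter x)
      with Cons \<open>P v\<close> assms(2) show ?thesis
        by simp
    next
      case (Bracket \<omega> u)
      with Cons less have "P u"
        by simp
      with Cons Bracket \<open>P v\<close> assms(3) show ?thesis
        by simp
    qed
  qed (simp add: assms)
qed

lemma mem_bwords_upto_iff: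
  "w \<in> bwords_upto \<Omega> X n \<longleftrightarrow> (\<forall>p\<in>set w. [p] \<in> bwords_upto \<Omega> X n)"
  by (cases n) auto

lemma bwords_upto_mono: "n \<le> m \<Longrightarrow> bwords_upto \<Omega> X n \<subseteq> bwords_upto \<Omega> X m"
proof (rule lift_Suc_mono_le[of "bwords_upto \<Omega> X"])
  show "bwords_upto \<Omega> X n \<subseteq> bwords_upto \<Omega> X (Suc n)" for n
  proof (induction n)
    case (Suc n)
    then show ?case
      unfolding bwords_upto.simps(2)[of _ _ "Suc n"] by (subst bwords_upto.simps(2), intro lists_mono) blast
  qed auto
qed

lemma Nil_in_bwords [simp]: "[] \<in> bwords \<Omega> X"
  by (auto simp: bwords_def intro: exI[of _ 0])

text \<open>The stages increase, so a prime factor and a word found in different stages both lie in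
  the stage \<open>max n m\<close>. The simplification rules derived from this make membership
  structural.\<close>

lemma Cons_in_bwords_aux: "p # w \<in> bwords \<Omega> X \<longleftrightarrow> [p] \<in> bwords \<Omega> X \<and> w \<in> bwords \<Omega> X"
proof
  assume "p # w \<in> bwords \<Omega> X"
  then show "[p] \<in> bwords \<Omega> X \<and> w \<in> bwords \<Omega> X"
    unfolding bwords_def using mem_bwords_upto_iff[of "p # w" \<Omega> X] mem_bwords_upto_iff[of w \<Omega> X]
    by fastforce
next
  assume "[p] \<in> bwords \<Omega> X \<and> w \<in> bwords \<Omega> X"
  then obtain n m where "[p] \<in> bwords_upto \<Omega> X n" "w \<in> bwords_upto \<Omega> X m"
    by (auto simp: bwords_def)
  then have "[p] \<in> bwords_upto \<Omega> X (max n m)" "w \<in> bwords_upto \<Omega> X (max n m)"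
    using bwords_upto_mono[of n "max n m" \<Omega> X] bwords_upto_mono[of m "max n m" \<Omega> X] by auto
  then have "p # w \<in> bwords_upto \<Omega> X (max n m)"
    using mem_bwords_upto_iff[of w] by (subst mem_bwords_upto_iff) auto
  then show "p # w \<in> bwords \<Omega> X"
    by (auto simp: bwords_def)
qed

lemma Letter_in_bwords: "[Letter x] \<in> bwords \<Omega> X \<longleftrightarrow> x \<in> X"
proof -
  have "[Letter x] \<in> bwords_upto \<Omega> X n \<longleftrightarrow> x \<in> X" for n
    by (cases n) auto
  then show ?thesis
    by (simp add: bwords_def)
qed

lemma Bracket_in_bwords: "[Bracket \<omega> u] \<in> bwords \<Omega> X \<longleftrightarrow> \<omega> \<in> \<Omega> \<and> u \<in> bwords \<Omega> X"
proof -
  have "[Bracket \<omega> u] \<notin> bwords_upto \<Omega> X 0"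
    by auto
  moreover have "[Bracket \<omega> u] \<in> bwords_upto \<Omega> X (Suc n) \<longleftrightarrow> \<omega> \<in> \<Omega> \<and> u \<in> bwords_upto \<Omega> X n" for n
    by auto
  ultimately show ?thesis
    unfolding bwords_def UN_iff by (metis UNIV_I not0_implies_Suc)
qed

lemma Cons_in_bwords [simp]:
  "Letter x # w \<in> bwords \<Omega> X \<longleftrightarrow> x \<in> X \<and> w \<in> bwords \<Omega> X"
  "Bracket \<omega> u # w \<in> bwords \<Omega> X \<longleftrightarrow> \<omega> \<in> \<Omega> \<and> u \<in> bwords \<Omega> X \<and> w \<in> bwords \<Omega> X"
  using Cons_in_bwords_aux[of "Letter x" w \<Omega> X] Cons_in_bwords_aux[of "Bracket \<omega> u" w \<Omega> X]
  by (simp_all add: Letter_in_bwords Bracket_in_bwords)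

lemma append_in_bwords [simp]:
  "u @ v \<in> bwords \<Omega> X \<longleftrightarrow> u \<in> bwords \<Omega> X \<and> v \<in> bwords \<Omega> X"
proof (induction u)
  case (Cons p u)
  then show ?case
    using Cons_in_bwords_aux[of p "u @ v" \<Omega> X] Cons_in_bwords_aux[of p u \<Omega> X] by auto
qed simp

section \<open>Words with one hole and their decomposition\<close>

abbreviation star :: "('w, 'x option) prime_word" where
  "star \<equiv> Letter None"

text \<open>Words and contexts have different letter types. This is the inclusion of ordinary words
  as star-free ones; \<open>star_free_word\<close> shows that it reaches all of them.\<close>

abbreviation emb :: "('w, 'x) word \<Rightarrow> ('w, 'x option) word" where
  "emb \<equiv> map (map_prime_word (\<lambda>\<omega>. \<omega>) Some)"

lemma star_count_simps [simp]:
  "star_count [] = 0"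
  "star_count (p # w) = star_count_prime p + star_count w"
  "star_count (u @ v) = star_count u + star_count v"
  by (simp_all add: star_count_def)

lemma star_count_prime_Bracket [simp]: "star_count_prime (Bracket \<omega> w) = star_count w"
  by (simp add: star_count_def)

declare star_count_prime.simps(3) [simp del]

lemma subst_word_simps [simp]:
  "subst_word u [] = []"
  "subst_word u (p # w) = subst_prime u p @ subst_word u w"
  "subst_word u (v @ w) = subst_word u v @ subst_word u w"
  by (simp_all add: subst_word_def)

lemma subst_prime_Bracket [simp]: "subst_prime u (Bracket \<omega> w) = [Bracket \<omega> (subst_word u w)]"
  by (simp add: subst_word_def)

declare subst_prime.simps(3) [simp del]

lemma star_count_emb [simp]: "star_count (emb w) = 0"
  by (induction w rule: word_induct) auto

lemma subst_word_emb [simp]: "subst_word u (emb w) = w"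
  by (induction w rule: word_induct) auto

lemma emb_in_bwords [simp]: "emb w \<in> bwords \<Omega> (insert None (Some ` X)) \<longleftrightarrow> w \<in> bwords \<Omega> X"
  by (induction w rule: word_induct) auto

lemma star_free_word:
  "q \<in> bwords \<Omega> (insert None (Some ` X)) \<Longrightarrow> star_count q = 0 \<Longrightarrow> \<exists>w\<in>bwords \<Omega> X. q = emb w"
proof (induction q rule: word_induct)
  case Nil
  show ?case
    by (auto intro: bexI[of _ "[]"])
next
  case (Letter x w)
  then obtain y where y: "x = Some y" "y \<in> X"
    by (cases x) auto
  with Letter obtain v where "v \<in> bwords \<Omega> X" "w = emb v"
    by auto
  note y this
  then show ?case
    by (intro bexI[of _ "Letter y # v"]) auto
next
  case (Bracket \<omega> u w)
  then obtain u' w' where "u' \<in> bwords \<Omega> X" "u = emb u'" "w' \<in> bwords \<Omega> X" "w = emb w'" "\<omega> \<in> \<Omega>"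
    by auto
  then show ?case
    by (intro bexI[of _ "Bracket \<omega> u' # w'"]) auto
qed

lemma star_in_star_words [simp]: "[star] \<in> star_words \<Omega> X"
  by (simp add: star_words_def)

lemma Bracket_in_star_words [simp]:
  "[Bracket \<omega> q] \<in> star_words \<Omega> X \<longleftrightarrow> \<omega> \<in> \<Omega> \<and> q \<in> star_words \<Omega> X"
  by (auto simp: star_words_def)

lemma concat_in_star_words:
  "q \<in> star_words \<Omega> X \<Longrightarrow> a \<in> bwords \<Omega> X \<Longrightarrow> b \<in> bwords \<Omega> X \<Longrightarrow> emb a @ q @ emb b \<in> star_words \<Omega> X"
  by (auto simp: star_words_def)

text \<open>Star counts add up to 1, so exactly one prime factor carries the hole and everything
  beside it is star-free. That factor is the hole itself or a bracket around a smaller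
  context.\<close>

lemma star_words_cases:
  assumes "q \<in> star_words \<Omega> X"
  obtains (star) a b where "a \<in> bwords \<Omega> X" "b \<in> bwords \<Omega> X" "q = emb a @ [star] @ emb b"
  | (Bracket) a b \<omega> q' where "a \<in> bwords \<Omega> X" "b \<in> bwords \<Omega> X" "\<omega> \<in> \<Omega>" "q' \<in> star_words \<Omega> X"
      "q = emb a @ [Bracket \<omega> q'] @ emb b"
proof -
  have "\<exists>a b. a \<in> bwords \<Omega> X \<and> b \<in> bwords \<Omega> X \<and> (q = emb a @ [star] @ emb b \<or>
    (\<exists>\<omega> q'. \<omega> \<in> \<Omega> \<and> q' \<in> star_words \<Omega> X \<and> q = emb a @ [Bracket \<omega> q'] @ emb b))"
    using assms
  proof (induction q)
    case Nil
    then show ?case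
      by (simp add: star_words_def)
  next
    case (Cons p q)
    have pq: "[p] \<in> bwords \<Omega> (insert None (Some ` X))" "q \<in> bwords \<Omega> (insert None (Some ` X))"
      "star_count_prime p + star_count q = 1"
      using Cons.prems Cons_in_bwords_aux[of p q] by (auto simp: star_words_def)
    show ?case
    proof (cases "star_count_prime p = 0")
      case True
      then obtain a where a: "a \<in> bwords \<Omega> X" "[p] = emb a"
        using star_free_word[of "[p]" \<Omega> X] pq by auto
      from Cons.IH[of] pq True obtain b c where bc: "b \<in> bwords \<Omega> X" "c \<in> bwords \<Omega> X"
        "q = emb b @ [star] @ emb c \<or>
          (\<exists>\<omega> q'. \<omega> \<in> \<Omega> \<and> q' \<in> star_words \<Omega> X \<and> q = emb b @ [Bracket \<omega> q'] @ emb c)"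
        by (auto simp: star_words_def)
      have "p # q = emb a @ q"
        using a by (metis append_Cons append_Nil)
      then show ?thesis
        using bc a by (intro exI[of _ "a @ b"] exI[of _ c]) auto
    next
      case False
      with pq have "star_count q = 0" and p1: "star_count_prime p = 1"
        by auto
      then obtain b where b: "b \<in> bwords \<Omega> X" "q = emb b"
        using star_free_word pq by blast
      show ?thesis
      proof (cases p)
        case (Letter x)
        with p1 have "x = None"
          by (cases x) auto
        with Letter b show ?thesis
          by (intro exI[of _ "[]"] exI[of _ b]) auto
      next
        case (Bracket \<omega> u)
        with p1 pq b show ?thesis
          by (intro exI[of _ "[]"] exI[of _ b]) (auto simp: star_words_def)
      qed
    qed
  qed
  then show ?thesis
    using that by blast
qed

text \<open>Contexts are generated from the bare hole by flanking and bracketing, so a property of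
  substitution has to be checked for these two operations only. The induction runs on degree because
  \<open>star_words_cases\<close> undoes a flanking and a bracketing at once.\<close>

lemma star_words_induct [consumes 1, case_names star concat Bracket]:
  assumes "q \<in> star_words \<Omega> X"
    and star: "P [star]"
    and concat: "\<And>q a b. q \<in> star_words \<Omega> X \<Longrightarrow> a \<in> bwords \<Omega> X \<Longrightarrow> b \<in> bwords \<Omega> X \<Longrightarrow> P q \<Longrightarrow>
      P (emb a @ q @ emb b)"
    and Bracket: "\<And>\<omega> q. q \<in> star_words \<Omega> X \<Longrightarrow> \<omega> \<in> \<Omega> \<Longrightarrow> P q \<Longrightarrow> P [Bracket \<omega> q]"
  shows "P q"
  using assms(1)
proof (induction q rule: measure_induct_rule[of deg_word])
  case (less q)
  from less.prems show ?case
  proof (cases rule: star_words_cases)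
    case (star a b)
    then show ?thesis
      using concat[of "[star]" a b] assms(2) by simp
  next
    case (Bracket a b \<omega> q')
    then have "P q'"
      by (intro less.IH) auto
    with Bracket assms(4)[of q' \<omega>] have "P [Bracket \<omega> q']"
      by simp
    then show ?thesis
      unfolding Bracket by (intro concat) (use Bracket in auto)
  qed
qed

lemma subst_word_in_bwords:
  "q \<in> star_words \<Omega> X \<Longrightarrow> u \<in> bwords \<Omega> X \<Longrightarrow> subst_word u q \<in> bwords \<Omega> X"
  by (induction rule: star_words_induct) auto

text \<open>Strict monotonicity of the order also asks that the two substituted words differ;
  cancelling the common context supplies this.\<close>

lemma inj_subst_word: "q \<in> star_words \<Omega> X \<Longrightarrow> subst_word u q = subst_word v q \<Longrightarrow> u = v"
  by (induction rule: star_words_induct) auto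

section \<open>The order\<close>

lemma db_less_iff:
  "db_less rO rX u v \<longleftrightarrow> deg_word u < deg_word v \<or>
    deg_word u = deg_word v \<and> (length u < length v \<or>
      (\<exists>p a b s t. u = p @ a # s \<and> v = p @ b # t \<and> length s = length t \<and> db_prime_less rO rX a b))"
  by (subst db_less.simps) fastforce

text \<open>Unspecified on letters; its value matters only where two brackets are compared.\<close>

fun prime_op :: "('w, 'x) prime_word \<Rightarrow> 'w" where
  "prime_op (Bracket \<omega> w) = \<omega>"

fun prime_arg :: "('w, 'x) prime_word \<Rightarrow> ('w, 'x) word" where
  "prime_arg (Letter x) = []"
| "prime_arg (Bracket \<omega> w) = w"

lemma db_prime_less_simps [simp]:
  "db_prime_less rO rX (Letter x) (Letter y) \<longleftrightarrow> (x, y) \<in> rX \<and> x \<noteq> y"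
  "db_prime_less rO rX (Letter x) (Bracket \<beta> v)"
  "\<not> db_prime_less rO rX (Bracket \<alpha> u) (Letter y)"
  "db_prime_less rO rX (Bracket \<alpha> u) (Bracket \<beta> v) \<longleftrightarrow> deg_word u < deg_word v \<or>
    deg_word u = deg_word v \<and> ((\<alpha>, \<beta>) \<in> rO \<and> \<alpha> \<noteq> \<beta> \<or> \<alpha> = \<beta> \<and> db_less rO rX u v)"
proof -
  show "db_prime_less rO rX (Letter x) (Bracket \<beta> v)"
    by (cases "deg_word v") (auto intro: db_letter_bracket db_prime_deg)
qed (subst db_prime_less.simps; auto)+

text \<open>Well-foundedness holds degree by degree: brackets of degree at most \<open>n + 1\<close> are compared
  through their arguments, which are words of degree at most \<open>n\<close>.\<close>

lemma wf_db_less_upto: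
  assumes "wf (rX - Id)" "wf (rO - Id)"
  shows "wf {(u, v). db_less rO rX u v \<and> deg_word v \<le> n}"
proof (induction n)
  case 0
  have "\<not> (db_less rO rX u v \<and> deg_word v \<le> 0)" for u v :: "('b, 'a) word"
    by (cases v) (auto simp: db_less_iff)
  then have "{(u, v). db_less rO rX u v \<and> deg_word v \<le> 0} = {}"
    by blast
  show ?case
    unfolding \<open>_ = {}\<close> by (rule wfI_min) auto
next
  case (Suc n)
  let ?W = "\<lambda>n. {(u, v). db_less rO rX u v \<and> deg_word v \<le> n}"
  let ?P = "{(a, b). db_prime_less rO rX a b \<and> deg_prime b \<le> Suc n}"
  let ?L = "inv_image (rX - Id) (\<lambda>p. case p of Letter x \<Rightarrow> x)"
  let ?B = "inv_image (less_than <*lex*> (rO - Id) <*lex*> ?W n)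
    (\<lambda>p. (deg_prime p, prime_op p, prime_arg p))"
  have wfs: "wf ?L" "wf ?B"
    using assms Suc by (auto intro!: wf_inv_image wf_lex_prod)
  have "wf ?P"
  proof (rule wfUNIVI)
    fix Q :: "('b, 'a) prime_word \<Rightarrow> bool" and p
    assume "\<forall>x. (\<forall>y. (y, x) \<in> ?P \<longrightarrow> Q y) \<longrightarrow> Q x"
    then have step: "Q b" if "\<And>a. db_prime_less rO rX a b \<Longrightarrow> deg_prime b \<le> Suc n \<Longrightarrow> Q a" for b
      using that by blast
    \<comment> \<open>A bracket is never below a letter, so the predecessors of a letter are letters
      and \<open>rX\<close> alone drives this induction. The induction over brackets may then take
      all letters for granted.\<close>
    have letters: "Q (Letter x)" for x
    proof -
      have "\<forall>x. p = Letter x \<longrightarrow> Q p" for p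
        using wfs(1)
      proof (induction p rule: wf_induct_rule)
        case (less p)
        show ?case
        proof (intro allI impI)
          fix x assume p: "p = Letter x"
          show "Q p"
          proof (rule step)
            fix a assume "db_prime_less rO rX a p"
            with p obtain y where "a = Letter y" "(a, p) \<in> ?L"
              by (cases a) auto
            with less show "Q a"
              by blast
          qed
        qed
      qed
      then show ?thesis
        by blast
    qed
    show "Q p"
      using wfs(2)
    proof (induction p rule: wf_induct_rule)
      case (less p)
      show ?case
      proof (cases p)
        case (Bracket \<omega> w)
        show ?thesis
        proof (rule step)
          fix a assume "db_prime_less rO rX a p" "deg_prime p \<le> Suc n"
          with less Bracket letters show "Q a"
            by (cases a) auto
        qed
      qed (simp add: letters)
    qed
  qed
  \<comment> \<open>\<open>lenlex\<close> compares breadth before the first differing factors and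
    stays well-founded, unlike the plain lexicographic order on words of unbounded length. A factor
    of a word of degree at most \<open>Suc n\<close> obeys the degree bound in
    \<open>?P\<close>.\<close>
  then have "wf (inv_image (less_than <*lex*> lenlex ?P) (\<lambda>w. (deg_word w, w)))"
    by (intro wf_inv_image wf_lex_prod wf_less_than wf_lenlex)
  moreover have "?W (Suc n) \<subseteq> inv_image (less_than <*lex*> lenlex ?P) (\<lambda>w. (deg_word w, w))"
  proof clarify
    fix u v assume "db_less rO rX u v" "deg_word v \<le> Suc n"
    then consider "deg_word u < deg_word v" | "deg_word u = deg_word v" "length u < length v"
      | p a b s t where "deg_word u = deg_word v" "u = p @ a # s" "v = p @ b # t"
        "length s = length t" "db_prime_less rO rX a b" "deg_prime b \<le> Suc n"
      by (force simp: db_less_iff)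
    then show "(u, v) \<in> inv_image (less_than <*lex*> lenlex ?P) (\<lambda>w. (deg_word w, w))"
    proof cases
      case 3
      then have "length u = length v"
        by simp
      with 3 have "(u, v) \<in> lex ?P"
        unfolding lex_conv by blast
      with 3 show ?thesis
        by (simp add: lenlex_conv)
    qed (simp_all add: lenlex_conv)
  qed
  ultimately show ?case
    by (rule wf_subset)
qed

text \<open>A smaller word never has larger degree. A minimal element among the members of
  \<open>Q\<close> of degree at most \<open>deg_word w\<close> is therefore minimal in all of
  \<open>Q\<close>, and the degree bound disappears.\<close>

lemma wf_db_less:
  assumes "wf (rX - Id)" "wf (rO - Id)"
  shows "wf {(u, v). db_less rO rX u v}"
proof (rule wfI_min)
  fix w :: "('b, 'a) word" and Q assume "w \<in> Q"
  then obtain z where z: "z \<in> Q" "deg_word z \<le> deg_word w"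
    and min: "\<And>y. db_less rO rX y z \<Longrightarrow> y \<notin> {v \<in> Q. deg_word v \<le> deg_word w}"
    using wfE_min[OF wf_db_less_upto[OF assms, of "deg_word w"], of w "{v \<in> Q. deg_word v \<le> deg_word w}"]
    by auto
  then show "\<exists>z\<in>Q. \<forall>y. (y, z) \<in> {(u, v). db_less rO rX u v} \<longrightarrow> y \<notin> Q"
    by (intro bexI[of _ z]) (fastforce simp: db_less_iff)+
qed

text \<open>Words of equal degree and breadth are decided at their first differing factors. Two
  brackets there may come down to their arguments, which have smaller degree than the whole word.
  Membership in \<open>bwords\<close> matters because \<open>rX\<close> and \<open>rO\<close> are
  total only on \<open>X\<close> and \<open>\<Omega>\<close>.\<close>

lemma db_less_total:
  assumes "total_on X rX" "total_on \<Omega> rO"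
  shows "u \<in> bwords \<Omega> X \<Longrightarrow> v \<in> bwords \<Omega> X \<Longrightarrow> u \<noteq> v \<Longrightarrow> db_less rO rX u v \<or> db_less rO rX v u"
proof (induction "deg_word u" arbitrary: u v rule: less_induct)
  case less
  show ?case
  proof (cases "deg_word u = deg_word v \<and> length u = length v")
    case True
    then obtain p a s b t where uv: "u = p @ a # s" "v = p @ b # t" "a \<noteq> b"
      using same_length_different[of u v] less.prems by (metis append_Cons append_Nil)
    with True have "length s = length t"
      by simp
    have ab: "[a] \<in> bwords \<Omega> X" "[b] \<in> bwords \<Omega> X"
      using less.prems uv Cons_in_bwords_aux[of a s] Cons_in_bwords_aux[of b t] by auto
    have "db_prime_less rO rX a b \<or> db_prime_less rO rX b a"
    proof (cases a)
      case (Letter x)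
      with ab assms uv show ?thesis
        by (cases b) (auto simp: total_on_def)
    next
      case a: (Bracket \<alpha> x)
      show ?thesis
      proof (cases b)
        case (Bracket \<beta> y)
        with less.hyps[of x y] a ab assms uv show ?thesis
          by (auto simp: total_on_def)
      qed (use a in auto)
    qed
    with uv True show ?thesis
      using \<open>length s = length t\<close> unfolding db_less_iff[of _ _ u] db_less_iff[of _ _ v] by metis
  qed (auto simp: db_less_iff)
qed

lemma well_order_db_order:
  assumes "well_order_on X rX" "well_order_on \<Omega> rO"
  shows "well_order_on (bwords \<Omega> X) (db_order \<Omega> X rO rX)"
proof -
  have wf: "wf {(u, v). db_less rO rX u v}"
    using assms by (intro wf_db_less) (auto simp: well_order_on_def)
  have total: "db_less rO rX u v \<or> db_less rO rX v u"
    if "u \<in> bwords \<Omega> X" "v \<in> bwords \<Omega> X" "u \<noteq> v" for u v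
    using db_less_total[of X rX \<Omega> rO u v] assms that
    by (auto simp: well_order_on_def linear_order_on_def)
  have asym: "\<not> db_less rO rX v u" if "db_less rO rX u v" for u v
    using wf_not_sym[OF wf] that by auto
  \<comment> \<open>No case analysis of the order is made: with totality and asymmetry, a failure
    would produce the cycle u < v < w < u, which a well-founded relation excludes.\<close>
  have trans: "db_less rO rX u w"
    if "u \<in> bwords \<Omega> X" "w \<in> bwords \<Omega> X" "db_less rO rX u v" "db_less rO rX v w" for u v w
  proof (rule ccontr)
    assume "\<not> db_less rO rX u w"
    with that total asym have "db_less rO rX w u"
      by metis
    have "w \<notin> {u, v, w}"
      using wfE_min[OF wf, of u "{u, v, w}"] that \<open>db_less rO rX w u\<close> by auto
    then show False
      by simp
  qed
  let ?r = "db_order \<Omega> X rO rX"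
  have "refl_on (bwords \<Omega> X) ?r"
    by (auto simp: refl_on_def db_order_def)
  moreover have "?r \<subseteq> bwords \<Omega> X \<times> bwords \<Omega> X"
    by (auto simp: db_order_def)
  moreover have "trans ?r"
    by (rule transI) (auto simp: db_order_def intro: trans)
  moreover have "antisym ?r"
    by (rule antisymI) (auto simp: db_order_def dest: asym)
  moreover have "total_on (bwords \<Omega> X) ?r"
    using total by (auto simp: total_on_def db_order_def)
  moreover have "wf (?r - Id)"
    by (rule wf_subset[OF wf]) (auto simp: db_order_def)
  ultimately show ?thesis
    by (simp add: well_order_on_def linear_order_on_def partial_order_on_def preorder_on_def)
qed

lemma db_less_irrefl:
  assumes "well_order_on X rX" "well_order_on \<Omega> rO"
  shows "\<not> db_less rO rX u u"
  using wf_not_refl[OF wf_db_less[of rX rO], of u] assms by (auto simp: well_order_on_def)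

lemma db_less_concat:
  assumes "db_less rO rX u v"
  shows "db_less rO rX (a @ u @ b) (a @ v @ b)"
  using assms
proof (cases rule: db_less.cases)
  case (db_factor p x s y t)
  then show ?thesis
    using db_less_db_prime_less.db_factor[of "a @ p" x "s @ b" y "t @ b" rO rX] by simp
qed (auto simp: db_less_iff)

lemma db_less_Bracket:
  "db_less rO rX u v \<Longrightarrow> db_less rO rX [Bracket \<omega> u] [Bracket \<omega> v]"
  by (auto simp: db_less_iff[of _ _ "[_]"] Cons_eq_append_conv)
    (auto simp: db_less_iff)

lemma db_less_subst:
  "q \<in> star_words \<Omega> X \<Longrightarrow> db_less rO rX u v \<Longrightarrow> db_less rO rX (subst_word u q) (subst_word v q)"
  by (induction rule: star_words_induct) (auto intro: db_less_concat db_less_Bracket)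

lemma monomial_db_order:
  assumes "well_order_on X rX" "well_order_on \<Omega> rO"
  shows "monomial_order \<Omega> X (db_order \<Omega> X rO rX)"
  using assms well_order_db_order
  by (auto simp: monomial_order_def db_order_def subst_word_in_bwords
      intro: db_less_subst dest: inj_subst_word)

section \<open>Linear extensions\<close>

lemma poly_mapping_eq_sum_single: "f = (\<Sum>w\<in>Poly_Mapping.keys f. Poly_Mapping.single w (Poly_Mapping.lookup f w))"
  by (rule poly_mapping_eqI)
    (auto simp: lookup_sum lookup_single when_def in_keys_iff if_distrib cong: if_cong)

text \<open>Both summands keep their support inside \<open>W\<close>, so the induction can be
  specialized to polynomials over admissible words and later over reduced words. Splitting into
  single terms involves no cancellation.\<close>

lemma poly_mapping_keys_induct [consumes 1, case_names zero single add]: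
  fixes f :: "'a \<Rightarrow>\<^sub>0 'b::comm_monoid_add"
  assumes "Poly_Mapping.keys f \<subseteq> W"
    and "P 0"
    and "\<And>w c. w \<in> W \<Longrightarrow> P (Poly_Mapping.single w c)"
    and "\<And>f g. Poly_Mapping.keys f \<subseteq> W \<Longrightarrow> Poly_Mapping.keys g \<subseteq> W \<Longrightarrow> P f \<Longrightarrow> P g \<Longrightarrow> P (f + g)"
  shows "P f"
proof -
  have "Poly_Mapping.keys (\<Sum>w\<in>F. Poly_Mapping.single w (h w)) \<subseteq> W \<and>
    P (\<Sum>w\<in>F. Poly_Mapping.single w (h w))"
    if "finite F" "F \<subseteq> W" for F h
    using that
  proof (induction F)
    case (insert w F)
    have "Poly_Mapping.keys (Poly_Mapping.single w (h w)) \<subseteq> W"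
      using insert by simp
    moreover have "Poly_Mapping.keys (Poly_Mapping.single w (h w) + (\<Sum>w\<in>F. Poly_Mapping.single w (h w))) \<subseteq> W"
      using keys_add[of "Poly_Mapping.single w (h w)" "\<Sum>w\<in>F. Poly_Mapping.single w (h w)"]
        insert \<open>Poly_Mapping.keys (Poly_Mapping.single w (h w)) \<subseteq> W\<close> by auto
    ultimately show ?case
      using insert assms(3)[of w "h w"] assms(4) by simp
  qed (simp add: assms)
  from this[of "Poly_Mapping.keys f"] show ?thesis
    using poly_mapping_eq_sum_single[of f] assms(1) by (metis finite_keys)
qed

lemma poly_mapping_induct [case_names zero single add]:
  fixes f :: "'a \<Rightarrow>\<^sub>0 'b::comm_monoid_add"
  assumes "P 0" "\<And>w c. P (Poly_Mapping.single w c)" "\<And>f g. P f \<Longrightarrow> P g \<Longrightarrow> P (f + g)"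
  shows "P f"
  using poly_mapping_keys_induct[of f UNIV P] assms by auto

lemma lookup_scale [simp]: "Poly_Mapping.lookup (scale c f) w = c * Poly_Mapping.lookup f w"
  by (simp add: map.rep_eq when_def)

lemma scale_simps:
  "scale c (f + g) = scale c f + scale c g"
  "scale c (f - g) = scale c f - scale c g"
  "scale c (- f) = - scale c f"
  "scale c 0 = 0"
  "scale 0 f = 0"
  "scale 1 f = f"
  "scale c (scale d f) = scale (c * d) f"
  "scale (- c) f = - scale c f"
  by (auto intro!: poly_mapping_eqI simp: lookup_add lookup_minus algebra_simps)

lemma scale_add_left: "scale (c + d) f = scale c f + scale d f"
  by (auto intro!: poly_mapping_eqI simp: lookup_add algebra_simps)

lemma scale_mult_left: "scale c f * g = scale c (f * g)"
  by (simp add: mult_map_scale_conv_mult mult.assoc)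

text \<open>Scaling is multiplication by the constant \<open>single 0 c\<close>, where
  \<open>0\<close> is the empty word. Constants are central since the coefficients commute, although
  words do not.\<close>

lemma scale_mult_right: "f * scale c g = scale c (f * g)"
proof -
  have "f * Poly_Mapping.single 0 c = Poly_Mapping.single 0 c * f"
    by (induction f rule: poly_mapping_induct)
      (simp_all add: mult_single mult.commute distrib_left distrib_right)
  then show ?thesis
    by (simp add: mult_map_scale_conv_mult flip: mult.assoc)
qed

lemmas scale_mult = scale_mult_left scale_mult_right

lemma single_eq_scale: "Poly_Mapping.single w c = scale c (mono_elt w)"
  by simp

text \<open>Linear extension with polynomial values. \<open>lin_ext\<close> is the case of word
  values, so the linearity of \<open>bracket_lin\<close> and \<open>subst_lin\<close> is inherited
  from here; the general case is used for the \<diamond>-product.\<close>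

definition word_lin_ext ::
    "(('w, 'x) word \<Rightarrow> ('w, 'x, 'k::comm_ring_1) bpoly) \<Rightarrow> ('w, 'x, 'k) bpoly \<Rightarrow> ('w, 'x, 'k) bpoly" where
  "word_lin_ext h f = (\<Sum>w \<in> Poly_Mapping.keys f. scale (Poly_Mapping.lookup f w) (h w))"

text \<open>The supports of f, g and f + g may all differ. Over a common finite superset the extra
  coefficients are zero, and additivity becomes a termwise matter.\<close>

lemma word_lin_ext_superset:
  assumes "finite F" "Poly_Mapping.keys f \<subseteq> F"
  shows "word_lin_ext h f = (\<Sum>w\<in>F. scale (Poly_Mapping.lookup f w) (h w))"
  unfolding word_lin_ext_def using assms
  by (intro sum.mono_neutral_left) (auto simp: in_keys_iff scale_simps)

lemma word_lin_ext_add: "word_lin_ext h (f + g) = word_lin_ext h f + word_lin_ext h g"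
proof -
  let ?F = "Poly_Mapping.keys f \<union> Poly_Mapping.keys g"
  have "word_lin_ext h f' = (\<Sum>w\<in>?F. scale (Poly_Mapping.lookup f' w) (h w))"
    if "Poly_Mapping.keys f' \<subseteq> ?F" for f'
    using that by (intro word_lin_ext_superset) auto
  from this[of f] this[of g] this[OF keys_add] show ?thesis
    by (simp add: lookup_add scale_add_left sum.distrib)
qed

lemma word_lin_ext_0 [simp]: "word_lin_ext h 0 = 0"
  by (simp add: word_lin_ext_def)

lemma word_lin_ext_uminus: "word_lin_ext h (- f) = - word_lin_ext h f"
  using word_lin_ext_add[of h f "- f"] by (simp add: eq_neg_iff_add_eq_0 add.commute)

lemma word_lin_ext_diff: "word_lin_ext h (f - g) = word_lin_ext h f - word_lin_ext h g"
  using word_lin_ext_add[of h f "- g"] by (simp add: word_lin_ext_uminus)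

lemma word_lin_ext_single: "word_lin_ext h (Poly_Mapping.single w c) = scale c (h w)"
  by (subst word_lin_ext_superset[of "{w}"]) auto

lemma word_lin_ext_scale: "word_lin_ext h (scale c f) = scale c (word_lin_ext h f)"
  by (induction f rule: poly_mapping_induct)
    (simp_all add: word_lin_ext_single word_lin_ext_add scale_simps)

lemmas word_lin_ext_simps = word_lin_ext_0 word_lin_ext_add word_lin_ext_uminus word_lin_ext_diff word_lin_ext_single word_lin_ext_scale

lemma lin_ext_eq_word_lin_ext: "lin_ext h = word_lin_ext (\<lambda>w. mono_elt (h w))"
  by (simp add: fun_eq_iff lin_ext_def word_lin_ext_def)

lemma bracket_lin_simps:
  "bracket_lin \<omega> 0 = 0"
  "bracket_lin \<omega> (f + g) = bracket_lin \<omega> f + bracket_lin \<omega> g"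
  "bracket_lin \<omega> (- f) = - bracket_lin \<omega> f"
  "bracket_lin \<omega> (f - g) = bracket_lin \<omega> f - bracket_lin \<omega> g"
  "bracket_lin \<omega> (scale c f) = scale c (bracket_lin \<omega> f)"
  by (simp_all add: bracket_lin_def lin_ext_eq_word_lin_ext word_lin_ext_simps)

lemma bracket_lin_single [simp]:
  "bracket_lin \<omega> (Poly_Mapping.single w c) = Poly_Mapping.single [Bracket \<omega> w] c"
  by (simp add: bracket_lin_def lin_ext_eq_word_lin_ext word_lin_ext_simps)

lemma subst_lin_simps:
  "subst_lin 0 q = 0"
  "subst_lin (f + g) q = subst_lin f q + subst_lin g q"
  "subst_lin (- f) q = - subst_lin f q"
  "subst_lin (f - g) q = subst_lin f q - subst_lin g q"
  "subst_lin (scale c f) q = scale c (subst_lin f q)"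
  by (simp_all add: subst_lin_def lin_ext_eq_word_lin_ext word_lin_ext_simps)

lemma subst_lin_single [simp]:
  "subst_lin (Poly_Mapping.single w c) q = Poly_Mapping.single (subst_word w q) c"
  by (simp add: subst_lin_def lin_ext_eq_word_lin_ext word_lin_ext_simps)

lemma mono_elt_mult: "mono_elt u * mono_elt v = mono_elt (u @ v)"
  by (simp add: mult_single plus_list_def)

lemma mono_elt_Nil [simp]: "mono_elt [] = 1"
  by (simp add: single_one[symmetric] zero_list_def del: single_one)

lemma subst_lin_star [simp]: "subst_lin f [star] = f"
  by (induction f rule: poly_mapping_induct) (simp_all add: subst_lin_simps)

text \<open>Together with \<open>subst_lin_Bracket\<close> this translates between contexts, in
  which triviality is phrased, and products and brackets of polynomials, in which the composition
  identities are phrased.\<close>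

lemma subst_lin_concat:
  "subst_lin f (emb a @ q @ emb b) = mono_elt a * subst_lin f q * mono_elt b"
  by (induction f rule: poly_mapping_induct)
    (simp_all add: subst_lin_simps algebra_simps mult_single plus_list_def)

lemma subst_lin_Bracket: "subst_lin f [Bracket \<omega> q] = bracket_lin \<omega> (subst_lin f q)"
  by (induction f rule: poly_mapping_induct) (simp_all add: subst_lin_simps bracket_lin_simps)

section \<open>The Groebner-Shirshov basis\<close>

definition rb_rel ::
    "('w \<Rightarrow> 'k) \<Rightarrow> 'w \<Rightarrow> ('w, 'x, 'k::comm_ring_1) bpoly \<Rightarrow> 'w \<Rightarrow> ('w, 'x, 'k) bpoly \<Rightarrow> ('w, 'x, 'k) bpoly" where
  "rb_rel lam \<alpha> f \<beta> g = bracket_lin \<alpha> f * bracket_lin \<beta> g - bracket_lin \<beta> (bracket_lin \<alpha> f * g)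
    - bracket_lin \<alpha> (f * bracket_lin \<beta> g) - scale (lam \<beta>) (bracket_lin \<alpha> (f * g))"

abbreviation rb_rel_word :: "('w \<Rightarrow> 'k) \<Rightarrow> 'w \<Rightarrow> ('w, 'x) word \<Rightarrow> 'w \<Rightarrow> ('w, 'x) word \<Rightarrow> ('w, 'x, 'k::comm_ring_1) bpoly" where
  "rb_rel_word lam \<alpha> u \<beta> v \<equiv> rb_rel lam \<alpha> (mono_elt u) \<beta> (mono_elt v)"

lemma rb_rel_word_eq:
  "rb_rel_word lam \<alpha> u \<beta> v = mono_elt [Bracket \<alpha> u, Bracket \<beta> v] - mono_elt [Bracket \<beta> (Bracket \<alpha> u # v)]
    - mono_elt [Bracket \<alpha> (u @ [Bracket \<beta> v])] - scale (lam \<beta>) (mono_elt [Bracket \<alpha> (u @ v)])"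
  by (simp add: rb_rel_def mult_single plus_list_def)

lemma S_M_eq:
  "S_M \<Omega> X lam = {rb_rel_word lam \<alpha> u \<beta> v | u v \<alpha> \<beta>. u \<in> bwords \<Omega> X \<and> v \<in> bwords \<Omega> X \<and> \<alpha> \<in> \<Omega> \<and> \<beta> \<in> \<Omega>}"
  by (simp add: S_M_def rb_rel_word_eq)

lemma rb_rel_word_in_S_M:
  "u \<in> bwords \<Omega> X \<Longrightarrow> v \<in> bwords \<Omega> X \<Longrightarrow> \<alpha> \<in> \<Omega> \<Longrightarrow> \<beta> \<in> \<Omega> \<Longrightarrow> rb_rel_word lam \<alpha> u \<beta> v \<in> S_M \<Omega> X lam"
  by (auto simp: S_M_eq)

lemma rb_rel_simps:
  "rb_rel lam \<alpha> (f + f') \<beta> g = rb_rel lam \<alpha> f \<beta> g + rb_rel lam \<alpha> f' \<beta> g"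
  "rb_rel lam \<alpha> (scale c f) \<beta> g = scale c (rb_rel lam \<alpha> f \<beta> g)"
  "rb_rel lam \<alpha> f \<beta> (g + g') = rb_rel lam \<alpha> f \<beta> g + rb_rel lam \<alpha> f \<beta> g'"
  "rb_rel lam \<alpha> f \<beta> (scale c g) = scale c (rb_rel lam \<alpha> f \<beta> g)"
  by (simp_all add: rb_rel_def bracket_lin_simps scale_simps scale_mult algebra_simps)

text \<open>Both sides expand \<open>\<lfloor>a\<rfloor>\<^sub>\<alpha>\<lfloor>b\<rfloor>\<^sub>\<beta>\<lfloor>c\<rfloor>\<^sub>\<gamma>\<close>, the left one by its two overlapping rules and the right one
  by the rules that then become applicable.\<close>

lemma rb_rel_intersection:
  "rb_rel lam \<alpha> a \<beta> b * bracket_lin \<gamma> c - bracket_lin \<alpha> a * rb_rel lam \<beta> b \<gamma> c =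
    rb_rel lam \<alpha> a \<gamma> (bracket_lin \<beta> b * c) + rb_rel lam \<alpha> a \<beta> (b * bracket_lin \<gamma> c)
    + scale (lam \<gamma>) (rb_rel lam \<alpha> a \<beta> (b * c)) + bracket_lin \<gamma> (rb_rel lam \<alpha> a \<beta> b * c)
    - rb_rel lam \<beta> (bracket_lin \<alpha> a * b) \<gamma> c - rb_rel lam \<alpha> (a * bracket_lin \<beta> b) \<gamma> c
    - scale (lam \<beta>) (rb_rel lam \<alpha> (a * b) \<gamma> c) - bracket_lin \<alpha> (a * rb_rel lam \<beta> b \<gamma> c)"
  by (simp add: rb_rel_def bracket_lin_simps scale_simps scale_mult algebra_simps)

text \<open>Additivity splits off \<open>rb_rel\<close> at \<open>f\<close>, whose product term is
  exactly what the left side subtracts. In the application \<open>f\<close> is a relation in a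
  context and \<open>f + g\<close> a single word; the two equations have it under the left and under
  the right bracket.\<close>

lemma rb_rel_including:
  "rb_rel lam \<alpha> (f + g) \<beta> h - bracket_lin \<alpha> f * bracket_lin \<beta> h =
    rb_rel lam \<alpha> g \<beta> h - bracket_lin \<beta> (bracket_lin \<alpha> f * h) - bracket_lin \<alpha> (f * bracket_lin \<beta> h)
    - scale (lam \<beta>) (bracket_lin \<alpha> (f * h))"
  "rb_rel lam \<alpha> h \<beta> (f + g) - bracket_lin \<alpha> h * bracket_lin \<beta> f =
    rb_rel lam \<alpha> h \<beta> g - bracket_lin \<beta> (bracket_lin \<alpha> h * f) - bracket_lin \<alpha> (h * bracket_lin \<beta> f)
    - scale (lam \<beta>) (bracket_lin \<alpha> (h * f))"
  by (simp_all add: rb_rel_def bracket_lin_simps scale_simps scale_mult algebra_simps)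

text \<open>Terms with zero coefficient can be filtered out of the sum. This frees the later
  arguments from showing coefficients nonzero, which may fail: a weight can vanish and the
  coefficients can have zero divisors.\<close>

lemma trivial_moduloI:
  assumes "h = (\<Sum>(c, q, s)\<leftarrow>ts. scale c (subst_lin s q))"
    and "\<And>c q s. (c, q, s) \<in> set ts \<Longrightarrow>
      q \<in> star_words \<Omega> X \<and> s \<in> S \<and> less_in ord (subst_word (lead_mon ord s) q) w"
  shows "trivial_modulo \<Omega> X ord S w h"
  unfolding trivial_modulo_def
proof (intro exI conjI)
  have "(\<Sum>(c, q, s)\<leftarrow>ts. scale c (subst_lin s q)) =
    (\<Sum>(c, q, s)\<leftarrow>filter (\<lambda>(c, q, s). c \<noteq> 0) ts. scale c (subst_lin s q))"
    by (induction ts) (auto simp: scale_simps)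
  with assms(1) show "h = (\<Sum>(c, q, s)\<leftarrow>filter (\<lambda>(c, q, s). c \<noteq> 0) ts. scale c (subst_lin s q))"
    by simp
qed (use assms(2) in auto)

lemma trivial_modulo_subst_lin:
  "q \<in> star_words \<Omega> X \<Longrightarrow> s \<in> S \<Longrightarrow> less_in ord (subst_word (lead_mon ord s) q) w \<Longrightarrow>
    trivial_modulo \<Omega> X ord S w (subst_lin s q)"
  by (rule trivial_moduloI[of _ "[(1, q, s)]"]) (auto simp: scale_simps)

lemma trivial_modulo_add:
  assumes "trivial_modulo \<Omega> X ord S w f" "trivial_modulo \<Omega> X ord S w g"
  shows "trivial_modulo \<Omega> X ord S w (f + g)"
proof -
  obtain ts where "f = (\<Sum>(c, q, s)\<leftarrow>ts. scale c (subst_lin s q))"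
    "\<forall>(c, q, s)\<in>set ts. c \<noteq> 0 \<and> q \<in> star_words \<Omega> X \<and> s \<in> S \<and> less_in ord (subst_word (lead_mon ord s) q) w"
    using assms(1) unfolding trivial_modulo_def by blast
  moreover obtain ts' where "g = (\<Sum>(c, q, s)\<leftarrow>ts'. scale c (subst_lin s q))"
    "\<forall>(c, q, s)\<in>set ts'. c \<noteq> 0 \<and> q \<in> star_words \<Omega> X \<and> s \<in> S \<and> less_in ord (subst_word (lead_mon ord s) q) w"
    using assms(2) unfolding trivial_modulo_def by blast
  ultimately show ?thesis
    by (intro trivial_moduloI[of _ "ts @ ts'"]) auto
qed

lemma trivial_modulo_scale:
  assumes "trivial_modulo \<Omega> X ord S w f"
  shows "trivial_modulo \<Omega> X ord S w (scale d f)"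
proof -
  obtain ts where ts: "f = (\<Sum>(c, q, s)\<leftarrow>ts. scale c (subst_lin s q))"
    "\<forall>(c, q, s)\<in>set ts. c \<noteq> 0 \<and> q \<in> star_words \<Omega> X \<and> s \<in> S \<and> less_in ord (subst_word (lead_mon ord s) q) w"
    using assms unfolding trivial_modulo_def by blast
  have "scale d (\<Sum>(c, q, s)\<leftarrow>ts. scale c (subst_lin s q)) =
    (\<Sum>(c, q, s)\<leftarrow>map (\<lambda>(c, q, s). (d * c, q, s)) ts. scale c (subst_lin s q))"
    by (induction ts) (auto simp: scale_simps)
  with ts show ?thesis
    by (intro trivial_moduloI[of _ "map (\<lambda>(c, q, s). (d * c, q, s)) ts"]) auto
qed

lemma trivial_modulo_diff:
  assumes "trivial_modulo \<Omega> X ord S w f" "trivial_modulo \<Omega> X ord S w g"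
  shows "trivial_modulo \<Omega> X ord S w (f - g)"
  using trivial_modulo_add[OF assms(1) trivial_modulo_scale[OF assms(2), of "- 1"]]
  by (simp add: scale_simps)

lemma lead_mon_eqI:
  assumes "antisym ord" "w \<in> Poly_Mapping.keys f" "\<And>v. v \<in> Poly_Mapping.keys f \<Longrightarrow> (v, w) \<in> ord"
  shows "lead_mon ord f = w"
  unfolding lead_mon_def by (rule the_equality) (use assms in \<open>auto dest: antisymD\<close>)

section \<open>Leading monomials and compositions of the Rota-Baxter relations\<close>

locale db_ordered =
  fixes X :: "'x set" and \<Omega> :: "'w set" and lam :: "'w \<Rightarrow> 'k::comm_ring_1"
    and rX :: "'x rel" and rO :: "'w rel"
  assumes wo_X: "well_order_on X rX" and wo_O: "well_order_on \<Omega> rO"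
begin

abbreviation ord :: "('w, 'x) word rel" where
  "ord \<equiv> db_order \<Omega> X rO rX"

abbreviation is_trivial :: "('w, 'x) word \<Rightarrow> ('w, 'x, 'k) bpoly \<Rightarrow> bool" where
  "is_trivial \<equiv> trivial_modulo \<Omega> X ord (S_M \<Omega> X lam)"

lemma less_in_ord:
  "less_in ord u v \<longleftrightarrow> u \<in> bwords \<Omega> X \<and> v \<in> bwords \<Omega> X \<and> db_less rO rX u v"
  using db_less_irrefl[OF wo_X wo_O] by (auto simp: db_order_def)

text \<open>Only an inclusion holds: \<open>lam \<beta>\<close> may be zero, and for \<alpha> =
  \<beta> and empty \<open>u\<close> and \<open>v\<close> the two nested words coincide, so that
  their coefficients add up and may cancel in characteristic 2.\<close>

lemma keys_rb_rel_word:
  "Poly_Mapping.keys (rb_rel_word lam \<alpha> u \<beta> v :: ('w, 'x, 'k) bpoly) \<subseteq>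
    {[Bracket \<alpha> u, Bracket \<beta> v], [Bracket \<beta> (Bracket \<alpha> u # v)],
     [Bracket \<alpha> (u @ [Bracket \<beta> v])], [Bracket \<alpha> (u @ v)]}"
  by (auto simp: rb_rel_word_eq in_keys_iff lookup_minus lookup_single when_def split: if_splits)

lemma lookup_rb_rel_word [simp]:
  "Poly_Mapping.lookup (rb_rel_word lam \<alpha> u \<beta> v :: ('w, 'x, 'k) bpoly) [Bracket \<alpha> u, Bracket \<beta> v] = 1"
  by (simp add: rb_rel_word_eq lookup_minus lookup_single)

text \<open>The product and the two nested words have the same degree
  \<open>deg_word u + deg_word v + 2\<close>, and breadth 2 beats breadth 1. The word carrying the
  weight has degree one less.\<close>

lemma lead_mon_rb_rel_word [simp]:
  assumes "u \<in> bwords \<Omega> X" "v \<in> bwords \<Omega> X" "\<alpha> \<in> \<Omega>" "\<beta> \<in> \<Omega>"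
  shows "lead_mon ord (rb_rel_word lam \<alpha> u \<beta> v) = [Bracket \<alpha> u, Bracket \<beta> v]"
proof (rule lead_mon_eqI)
  show "antisym ord"
    using well_order_db_order[OF wo_X wo_O]
    by (simp add: well_order_on_def linear_order_on_def partial_order_on_def)
  show "(w, [Bracket \<alpha> u, Bracket \<beta> v]) \<in> ord" if "w \<in> Poly_Mapping.keys (rb_rel_word lam \<alpha> u \<beta> v)" for w
    using subsetD[OF keys_rb_rel_word that] assms by (auto simp: db_order_def db_less_iff)
qed (simp add: in_keys_iff)

lemma trivial_context:
  assumes "q \<in> star_words \<Omega> X" "u \<in> bwords \<Omega> X" "v \<in> bwords \<Omega> X" "\<alpha> \<in> \<Omega>" "\<beta> \<in> \<Omega>"
    and "w \<in> bwords \<Omega> X" "db_less rO rX (subst_word [Bracket \<alpha> u, Bracket \<beta> v] q) w"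
  shows "is_trivial w (subst_lin (rb_rel_word lam \<alpha> u \<beta> v) q)"
  using assms
  by (intro trivial_modulo_subst_lin rb_rel_word_in_S_M)
    (auto simp: less_in_ord intro!: subst_word_in_bwords simp del: subst_word_simps)

lemma trivial_rb_rel_word:
  assumes "u \<in> bwords \<Omega> X" "v \<in> bwords \<Omega> X" "\<alpha> \<in> \<Omega>" "\<beta> \<in> \<Omega>"
    and "w \<in> bwords \<Omega> X" "db_less rO rX [Bracket \<alpha> u, Bracket \<beta> v] w"
  shows "is_trivial w (rb_rel_word lam \<alpha> u \<beta> v)"
  using trivial_context[of "[star]" u v \<alpha> \<beta> w] assms by simp

lemma trivial_intersection:
  assumes abc: "a \<in> bwords \<Omega> X" "b \<in> bwords \<Omega> X" "c \<in> bwords \<Omega> X" "\<alpha> \<in> \<Omega>" "\<beta> \<in> \<Omega>" "\<gamma> \<in> \<Omega>"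
  shows "is_trivial [Bracket \<alpha> a, Bracket \<beta> b, Bracket \<gamma> c]
    (rb_rel_word lam \<alpha> a \<beta> b * mono_elt [Bracket \<gamma> c] - mono_elt [Bracket \<alpha> a] * rb_rel_word lam \<beta> b \<gamma> c)"
proof -
  let ?w = "[Bracket \<alpha> a, Bracket \<beta> b, Bracket \<gamma> c]"
  note less = db_less_iff[of rO rX _ ?w]
  have "is_trivial ?w (bracket_lin \<gamma> (rb_rel_word lam \<alpha> a \<beta> b * mono_elt c))"
    using trivial_context[of "[Bracket \<gamma> (emb [] @ [star] @ emb c)]" a b \<alpha> \<beta> ?w] abc
    unfolding subst_lin_Bracket subst_lin_concat by (simp add: less star_words_def)
  moreover have "is_trivial ?w (bracket_lin \<alpha> (mono_elt a * rb_rel_word lam \<beta> b \<gamma> c))"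
    using trivial_context[of "[Bracket \<alpha> (emb a @ [star] @ emb [])]" b c \<beta> \<gamma> ?w] abc
    unfolding subst_lin_Bracket subst_lin_concat by (simp add: less star_words_def)
  \<comment> \<open>The ambiguity has degree \<open>deg_word a + deg_word b + deg_word c + 3\<close>
    and a bare relation adds 2 to the degrees of its arguments. The bound thus allows equal degree,
    where breadth 2 < 3 decides.\<close>
  moreover have "is_trivial ?w (rb_rel_word lam \<delta> u \<epsilon> v)"
    if "u \<in> bwords \<Omega> X" "v \<in> bwords \<Omega> X" "\<delta> \<in> \<Omega>" "\<epsilon> \<in> \<Omega>"
      "deg_word u + deg_word v \<le> deg_word a + deg_word b + deg_word c + 1" for \<delta> u \<epsilon> v
    using abc that by (intro trivial_rb_rel_word) (auto simp: less)
  ultimately show ?thesis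
    using rb_rel_intersection[of lam \<alpha> "mono_elt a" \<beta> "mono_elt b" \<gamma> "mono_elt c"] abc
    unfolding bracket_lin_single mono_elt_mult
    by (auto intro!: trivial_modulo_add trivial_modulo_diff trivial_modulo_scale simp del: mono_elt_Nil)
qed

text \<open>With \<open>g\<close> read as its leading monomial plus the tail, the composition splits into instances of
  the relation at the tail, inside the same brackets, and the remaining terms with \<open>g\<close> in place.\<close>

lemma trivial_including:
  assumes q: "q \<in> star_words \<Omega> X" and "u \<in> bwords \<Omega> X" "v \<in> bwords \<Omega> X" "\<alpha> \<in> \<Omega>" "\<beta> \<in> \<Omega>"
    and c: "c \<in> bwords \<Omega> X" "\<gamma> \<in> \<Omega>" "\<delta> \<in> \<Omega>"
  shows "is_trivial [Bracket \<gamma> (subst_word [Bracket \<alpha> u, Bracket \<beta> v] q), Bracket \<delta> c]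
      (rb_rel_word lam \<gamma> (subst_word [Bracket \<alpha> u, Bracket \<beta> v] q) \<delta> c
        - subst_lin (rb_rel_word lam \<alpha> u \<beta> v) ([Bracket \<gamma> q, Bracket \<delta> (emb c)]))" (is "is_trivial ?w1 ?h1")
    and "is_trivial [Bracket \<gamma> c, Bracket \<delta> (subst_word [Bracket \<alpha> u, Bracket \<beta> v] q)]
      (rb_rel_word lam \<gamma> c \<delta> (subst_word [Bracket \<alpha> u, Bracket \<beta> v] q)
        - subst_lin (rb_rel_word lam \<alpha> u \<beta> v) ([Bracket \<gamma> (emb c), Bracket \<delta> q]))" (is "is_trivial ?w2 ?h2")
proof -
  let ?l = "[Bracket \<alpha> u, Bracket \<beta> v]" and ?g = "rb_rel_word lam \<alpha> u \<beta> v"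
  let ?t1 = "[Bracket \<beta> (Bracket \<alpha> u # v)]" and ?t2 = "[Bracket \<alpha> (u @ [Bracket \<beta> v])]"
    and ?t3 = "[Bracket \<alpha> (u @ v)]"
  let ?tail = "mono_elt (subst_word ?t1 q) + mono_elt (subst_word ?t2 q)
    + scale (lam \<beta>) (mono_elt (subst_word ?t3 q))"
  have split: "mono_elt (subst_word ?l q) = subst_lin ?g q + ?tail"
    by (simp add: rb_rel_word_eq subst_lin_simps)
  note bw = assms(2-)
  have less: "db_less rO rX (subst_word t q) (subst_word ?l q)" "subst_word t q \<in> bwords \<Omega> X"
    if "t \<in> {?t1, ?t2, ?t3}" for t
  proof -
    have "db_less rO rX t ?l" "t \<in> bwords \<Omega> X"
      using that bw by (auto simp: db_less_iff)
    then show "db_less rO rX (subst_word t q) (subst_word ?l q)" "subst_word t q \<in> bwords \<Omega> X"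
      by (simp_all add: db_less_subst[OF q] subst_word_in_bwords[OF q] del: subst_word_simps)
  qed
  have l: "subst_word ?l q \<in> bwords \<Omega> X"
    using bw by (intro subst_word_in_bwords[OF q]) auto
  have ctx: "is_trivial w (subst_lin ?g p)"
    if "p \<in> star_words \<Omega> X" "w \<in> bwords \<Omega> X" "db_less rO rX (subst_word ?l p) w" for p w
    using that bw by (intro trivial_context)
  have c': "subst_lin ?g ([Bracket \<gamma> q, Bracket \<delta> (emb c)]) = bracket_lin \<gamma> (subst_lin ?g q) * bracket_lin \<delta> (mono_elt c)"
    "subst_lin ?g ([Bracket \<gamma> (emb c), Bracket \<delta> q]) = bracket_lin \<gamma> (mono_elt c) * bracket_lin \<delta> (subst_lin ?g q)"
    using subst_lin_concat[of ?g "[]" "[Bracket \<gamma> q]" "[Bracket \<delta> c]"]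
      subst_lin_concat[of ?g "[Bracket \<gamma> c]" "[Bracket \<delta> q]" "[]"]
    by (simp_all add: subst_lin_Bracket)
  \<comment> \<open>Each tail word is below the leading word already inside \<open>q\<close>; the
    outer bracket and the neighbouring factor preserve this.\<close>
  have tail1: "is_trivial ?w1 (rb_rel_word lam \<gamma> (subst_word t q) \<delta> c)" if "t \<in> {?t1, ?t2, ?t3}" for t
    using less[OF that] l c db_less_concat[OF db_less_Bracket[OF less(1)[OF that]], of "[]" \<gamma> "[Bracket \<delta> c]"]
    by (intro trivial_rb_rel_word) auto
  have tail2: "is_trivial ?w2 (rb_rel_word lam \<gamma> c \<delta> (subst_word t q))" if "t \<in> {?t1, ?t2, ?t3}" for t
    using less[OF that] l c db_less_concat[OF db_less_Bracket[OF less(1)[OF that]], of "[Bracket \<gamma> c]" \<delta> "[]"]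
    by (intro trivial_rb_rel_word) auto
  \<comment> \<open>In the three terms that keep the relation in place, everything sits under one
    outer bracket. The first two have the degree of the ambiguity but breadth 1 instead of 2; the
    weight term has smaller degree.\<close>
  have "is_trivial ?w1 (bracket_lin \<delta> (bracket_lin \<gamma> (subst_lin ?g q) * mono_elt c))"
    using ctx[of "[Bracket \<delta> (emb [] @ [Bracket \<gamma> q] @ emb c)]" ?w1] c q l
      concat_in_star_words[of "[Bracket \<gamma> q]" \<Omega> X "[]" c]
    unfolding subst_lin_Bracket subst_lin_concat by (simp add: db_less_iff)
  moreover have "is_trivial ?w1 (bracket_lin \<gamma> (subst_lin ?g q * bracket_lin \<delta> (mono_elt c)))"
    using ctx[of "[Bracket \<gamma> (emb [] @ q @ emb [Bracket \<delta> c])]" ?w1] c q l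
      concat_in_star_words[of q \<Omega> X "[]" "[Bracket \<delta> c]"]
    unfolding subst_lin_Bracket subst_lin_concat by (simp add: db_less_iff)
  moreover have "is_trivial ?w1 (bracket_lin \<gamma> (subst_lin ?g q * mono_elt c))"
    using ctx[of "[Bracket \<gamma> (emb [] @ q @ emb c)]" ?w1] c q l
      concat_in_star_words[of q \<Omega> X "[]" c]
    unfolding subst_lin_Bracket subst_lin_concat by (simp add: db_less_iff)
  ultimately show "is_trivial ?w1 ?h1"
    unfolding split c' rb_rel_including(1) unfolding rb_rel_simps
    by (intro trivial_modulo_add trivial_modulo_diff trivial_modulo_scale tail1) simp_all
  have "is_trivial ?w2 (bracket_lin \<delta> (bracket_lin \<gamma> (mono_elt c) * subst_lin ?g q))"
    using ctx[of "[Bracket \<delta> (emb [Bracket \<gamma> c] @ q @ emb [])]" ?w2] c q l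
      concat_in_star_words[of q \<Omega> X "[Bracket \<gamma> c]" "[]"]
    unfolding subst_lin_Bracket subst_lin_concat by (simp add: db_less_iff)
  moreover have "is_trivial ?w2 (bracket_lin \<gamma> (mono_elt c * bracket_lin \<delta> (subst_lin ?g q)))"
    using ctx[of "[Bracket \<gamma> (emb c @ [Bracket \<delta> q] @ emb [])]" ?w2] c q l
      concat_in_star_words[of "[Bracket \<delta> q]" \<Omega> X c "[]"]
    unfolding subst_lin_Bracket subst_lin_concat by (simp add: db_less_iff)
  moreover have "is_trivial ?w2 (bracket_lin \<gamma> (mono_elt c * subst_lin ?g q))"
    using ctx[of "[Bracket \<gamma> (emb c @ q @ emb [])]" ?w2] c q l
      concat_in_star_words[of q \<Omega> X c "[]"]
    unfolding subst_lin_Bracket subst_lin_concat by (simp add: db_less_iff)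
  ultimately show "is_trivial ?w2 ?h2"
    unfolding split c' rb_rel_including(2) unfolding rb_rel_simps
    by (intro trivial_modulo_add trivial_modulo_diff trivial_modulo_scale tail2) simp_all
qed

lemma groebner_shirshov_S_M: "groebner_shirshov_basis \<Omega> X ord (S_M \<Omega> X lam)"
  unfolding groebner_shirshov_basis_def
proof (intro conjI ballI impI allI)
  show "S_M \<Omega> X lam \<subseteq> bpolys \<Omega> X"
  proof
    fix s assume "s \<in> S_M \<Omega> X lam"
    then obtain u v \<alpha> \<beta> where s: "s = rb_rel_word lam \<alpha> u \<beta> v" "u \<in> bwords \<Omega> X" "v \<in> bwords \<Omega> X" "\<alpha> \<in> \<Omega>" "\<beta> \<in> \<Omega>"
      by (auto simp: S_M_eq)
    then show "s \<in> bpolys \<Omega> X"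
      using keys_rb_rel_word[of \<alpha> u \<beta> v] by (auto simp: bpolys_def)
  qed
next
  fix s assume "s \<in> S_M \<Omega> X lam"
  then obtain u v \<alpha> \<beta> where s: "s = rb_rel_word lam \<alpha> u \<beta> v" "u \<in> bwords \<Omega> X" "v \<in> bwords \<Omega> X" "\<alpha> \<in> \<Omega>" "\<beta> \<in> \<Omega>"
    by (auto simp: S_M_eq)
  then show "monic ord s"
    using lookup_rb_rel_word[of \<alpha> u \<beta> v] by (auto simp: monic_def simp del: lookup_rb_rel_word)
next
  fix f g w h
  assume "f \<in> S_M \<Omega> X lam" "g \<in> S_M \<Omega> X lam" and "f \<noteq> g"
    and comp: "intersection_composition \<Omega> X ord f g w h \<or> including_composition \<Omega> X ord f g w h"
  then obtain a b \<alpha> \<beta> c d \<gamma> \<delta> where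
    f: "f = rb_rel_word lam \<alpha> a \<beta> b" "a \<in> bwords \<Omega> X" "b \<in> bwords \<Omega> X" "\<alpha> \<in> \<Omega>" "\<beta> \<in> \<Omega>" and
    g: "g = rb_rel_word lam \<gamma> c \<delta> d" "c \<in> bwords \<Omega> X" "d \<in> bwords \<Omega> X" "\<gamma> \<in> \<Omega>" "\<delta> \<in> \<Omega>"
    by (auto simp: S_M_eq)
  from comp show "is_trivial w h"
  proof
    assume "intersection_composition \<Omega> X ord f g w h"
    then obtain u v where uv: "[Bracket \<alpha> a, Bracket \<beta> b] @ u = v @ [Bracket \<gamma> c, Bracket \<delta> d]"
      "w = [Bracket \<alpha> a, Bracket \<beta> b] @ u" "2 < length w" "length w < 4"
      "h = f * mono_elt u - mono_elt v * g"
      using f g by (auto simp: intersection_composition_def)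
    \<comment> \<open>Both leading monomials have breadth 2, so the ambiguity has breadth strictly
      between 2 and 4 and the overlap is a single bracket.\<close>
    then obtain p p' where "u = [p]" "v = [p']"
      by (cases u; cases v; cases "tl u"; cases "tl v") auto
    with uv have "v = [Bracket \<alpha> a]" "u = [Bracket \<delta> d]" "\<gamma> = \<beta>" "c = b"
      by auto
    with uv f g show ?thesis
      using trivial_intersection[of a b d \<alpha> \<beta> \<delta>] by simp
  next
    assume "including_composition \<Omega> X ord f g w h"
    then obtain q where q: "q \<in> star_words \<Omega> X" "w = [Bracket \<alpha> a, Bracket \<beta> b]"
      "subst_word [Bracket \<gamma> c, Bracket \<delta> d] q = [Bracket \<alpha> a, Bracket \<beta> b]" "h = f - subst_lin g q"
      using f g by (auto simp: including_composition_def)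
    from q(1) show ?thesis
    proof (cases rule: star_words_cases)
      \<comment> \<open>With the hole at top level, equal breadth forces the leading monomials to
        agree. They determine all four parameters, contradicting that \<open>f\<close> and
        \<open>g\<close> are distinct.\<close>
      case (star l r)
      with q(3) have "\<alpha> = \<gamma> \<and> \<beta> = \<delta> \<and> a = c \<and> b = d"
        by (auto simp: append_eq_Cons_conv Cons_eq_append_conv)
      with f g \<open>f \<noteq> g\<close> show ?thesis
        by simp
    next
      case (Bracket l r \<omega> q')
      with q(3) consider "l = []" "r = [Bracket \<beta> b]" "\<omega> = \<alpha>" "subst_word [Bracket \<gamma> c, Bracket \<delta> d] q' = a"
        | "r = []" "l = [Bracket \<alpha> a]" "\<omega> = \<beta>" "subst_word [Bracket \<gamma> c, Bracket \<delta> d] q' = b"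
        by (auto simp: append_eq_Cons_conv Cons_eq_append_conv)
      then show ?thesis
        using trivial_including(1)[of q' c d \<gamma> \<delta> b \<alpha> \<beta>] trivial_including(2)[of q' c d \<gamma> \<delta> a \<alpha> \<beta>] Bracket f g q
        by cases auto
    qed
  qed
qed

end

section \<open>Operated algebras and evaluation of bracketed words\<close>

lemma coeff_ring_simps [simp]:
  "carrier coeff_ring = UNIV" "a \<otimes>\<^bsub>coeff_ring\<^esub> b = a * b" "\<one>\<^bsub>coeff_ring\<^esub> = 1"
  "\<zero>\<^bsub>coeff_ring\<^esub> = 0" "a \<oplus>\<^bsub>coeff_ring\<^esub> b = a + b"
  by (simp_all add: coeff_ring_def)

lemma cring_coeff_ring: "cring (coeff_ring :: 'k::comm_ring_1 ring)"
proof (intro cringI abelian_groupI comm_monoidI)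
  show "\<exists>b\<in>carrier coeff_ring. b \<oplus>\<^bsub>coeff_ring\<^esub> a = \<zero>\<^bsub>coeff_ring\<^esub>" for a :: 'k
    by (auto intro: exI[of _ "- a"])
qed (auto simp: algebra_simps)

text \<open>Carrier, product and unit are left open so that the same argument serves concatenation
  on \<open>bpolys\<close> and the \<diamond>-product on all polynomials; addition, scalars and
  brackets are shared.\<close>

lemma operated_algebra_bpolyI:
  fixes C :: "('w, 'x, 'k::comm_ring_1) bpoly set"
  assumes "0 \<in> C" "e \<in> C"
    and "\<And>f g. f \<in> C \<Longrightarrow> g \<in> C \<Longrightarrow> f + g \<in> C"
    and "\<And>c f. f \<in> C \<Longrightarrow> scale c f \<in> C"
    and "\<And>f g. f \<in> C \<Longrightarrow> g \<in> C \<Longrightarrow> m f g \<in> C"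
    and "\<And>\<omega> f. \<omega> \<in> \<Omega> \<Longrightarrow> f \<in> C \<Longrightarrow> bracket_lin \<omega> f \<in> C"
    and "\<And>f. m e f = f" "\<And>f. m f e = f"
    and "\<And>f g h. m (m f g) h = m f (m g h)"
    and "\<And>f g h. m (f + g) h = m f h + m g h"
    and "\<And>f g h. m f (g + h) = m f g + m f h"
    and "\<And>c f g. m (scale c f) g = scale c (m f g)"
    and "\<And>c f g. m f (scale c g) = scale c (m f g)"
  shows "operated_algebra \<Omega>
    \<lparr>carrier = C, monoid.mult = m, one = e, zero = 0, add = (+), smult = scale, oper = bracket_lin\<rparr>"
    (is "operated_algebra \<Omega> ?A")
proof -
  have "abelian_group ?A"
  proof (rule abelian_groupI)
    show "\<exists>g\<in>carrier ?A. g \<oplus>\<^bsub>?A\<^esub> f = \<zero>\<^bsub>?A\<^esub>" if "f \<in> carrier ?A" for f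
      using that assms(4)[of f "- 1"] by (intro bexI[of _ "- f"]) (auto simp: scale_simps)
  qed (use assms(1-3) in \<open>auto simp: algebra_simps\<close>)
  moreover have "Group.monoid ?A"
    by (rule monoidI) (use assms in auto)
  ultimately have "ring ?A"
    by (intro ringI) (use assms in auto)
  moreover have "module coeff_ring ?A"
    by (intro moduleI cring_coeff_ring \<open>abelian_group ?A\<close>)
      (use assms(4) in \<open>auto simp: scale_simps scale_add_left\<close>)
  ultimately show ?thesis
    using assms by (auto simp: operated_algebra_def bracket_lin_simps)
qed

lemma keys_add_subset:
  "Poly_Mapping.keys f \<subseteq> W \<Longrightarrow> Poly_Mapping.keys g \<subseteq> W \<Longrightarrow> Poly_Mapping.keys (f + g) \<subseteq> W"
  using keys_add[of f g] by auto

lemma keys_scale: "Poly_Mapping.keys (scale c f) \<subseteq> Poly_Mapping.keys f"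
  by (auto simp: in_keys_iff)

lemma keys_bracket_lin:
  fixes f :: "('w, 'x, 'k::comm_ring_1) bpoly"
  shows "Poly_Mapping.keys f \<subseteq> W \<Longrightarrow>
    Poly_Mapping.keys (bracket_lin \<omega> f) \<subseteq> (\<lambda>u. [Bracket \<omega> u]) ` W"
  by (induction rule: poly_mapping_keys_induct)
    (simp_all add: bracket_lin_simps keys_add_subset)

lemma bpolys_closed:
  fixes f g :: "('w, 'x, 'k::comm_ring_1) bpoly"
  shows "0 \<in> bpolys \<Omega> X" "1 \<in> bpolys \<Omega> X"
  "f \<in> bpolys \<Omega> X \<Longrightarrow> g \<in> bpolys \<Omega> X \<Longrightarrow> f + g \<in> bpolys \<Omega> X"
  "f \<in> bpolys \<Omega> X \<Longrightarrow> g \<in> bpolys \<Omega> X \<Longrightarrow> f - g \<in> bpolys \<Omega> X"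
  "f \<in> bpolys \<Omega> X \<Longrightarrow> g \<in> bpolys \<Omega> X \<Longrightarrow> f * g \<in> bpolys \<Omega> X"
  "f \<in> bpolys \<Omega> X \<Longrightarrow> scale c f \<in> bpolys \<Omega> X"
  "\<omega> \<in> \<Omega> \<Longrightarrow> f \<in> bpolys \<Omega> X \<Longrightarrow> bracket_lin \<omega> f \<in> bpolys \<Omega> X"
  "w \<in> bwords \<Omega> X \<Longrightarrow> Poly_Mapping.single w c \<in> bpolys \<Omega> X"
proof -
  show "f * g \<in> bpolys \<Omega> X" if "f \<in> bpolys \<Omega> X" "g \<in> bpolys \<Omega> X" for f g :: "('w, 'x, 'k) bpoly"
    using keys_mult[of f g] that by (fastforce simp: bpolys_def plus_list_def)
  show add: "f + g \<in> bpolys \<Omega> X" if "f \<in> bpolys \<Omega> X" "g \<in> bpolys \<Omega> X" for f g :: "('w, 'x, 'k) bpoly"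
    using that keys_add[of f g] by (auto simp: bpolys_def)
  show scale: "scale c f \<in> bpolys \<Omega> X" if "f \<in> bpolys \<Omega> X" for c and f :: "('w, 'x, 'k) bpoly"
    using that keys_scale[of c f] by (auto simp: bpolys_def)
  show "f - g \<in> bpolys \<Omega> X" if "f \<in> bpolys \<Omega> X" "g \<in> bpolys \<Omega> X" for f g :: "('w, 'x, 'k) bpoly"
    using add[OF that(1) scale[OF that(2), of "- 1"]] by (simp add: scale_simps)
  show "bracket_lin \<omega> f \<in> bpolys \<Omega> X" if "\<omega> \<in> \<Omega>" "f \<in> bpolys \<Omega> X" for \<omega> and f :: "('w, 'x, 'k) bpoly"
    using that keys_bracket_lin[of f "bwords \<Omega> X" \<omega>] by (auto simp: bpolys_def)
qed (auto simp: bpolys_def zero_list_def)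

lemma bpolys_induct [consumes 1, case_names zero single add]:
  assumes "f \<in> bpolys \<Omega> X" "P 0" "\<And>w c. w \<in> bwords \<Omega> X \<Longrightarrow> P (Poly_Mapping.single w c)"
    and "\<And>f g. f \<in> bpolys \<Omega> X \<Longrightarrow> g \<in> bpolys \<Omega> X \<Longrightarrow> P f \<Longrightarrow> P g \<Longrightarrow> P (f + g)"
  shows "P f"
  using assms unfolding bpolys_def by (intro poly_mapping_keys_induct[of f "bwords \<Omega> X" P]) auto

lemma operated_bword_alg: "operated_algebra \<Omega> (bword_alg \<Omega> X)"
  unfolding bword_alg_def
  by (rule operated_algebra_bpolyI)
    (simp_all add: bpolys_closed scale_mult distrib_left distrib_right mult.assoc)

lemma bword_alg_simps [simp]:
  "carrier (bword_alg \<Omega> X) = bpolys \<Omega> X"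
  "f \<otimes>\<^bsub>bword_alg \<Omega> X\<^esub> g = f * g" "\<one>\<^bsub>bword_alg \<Omega> X\<^esub> = 1" "\<zero>\<^bsub>bword_alg \<Omega> X\<^esub> = 0"
  "f \<oplus>\<^bsub>bword_alg \<Omega> X\<^esub> g = f + g" "c \<odot>\<^bsub>bword_alg \<Omega> X\<^esub> f = scale c f"
  "oper (bword_alg \<Omega> X) = bracket_lin"
  by (simp_all add: bword_alg_def)

section \<open>Evaluation homomorphisms out of the free operated algebra\<close>

function ev_word :: "('k, 'a, 'w) operated_alg \<Rightarrow> ('x \<Rightarrow> 'a) \<Rightarrow> ('w, 'x) word \<Rightarrow> 'a" where
  "ev_word A f [] = \<one>\<^bsub>A\<^esub>"
| "ev_word A f (Letter x # w) = f x \<otimes>\<^bsub>A\<^esub> ev_word A f w"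
| "ev_word A f (Bracket \<omega> u # w) = oper A \<omega> (ev_word A f u) \<otimes>\<^bsub>A\<^esub> ev_word A f w"
  by pat_completeness auto
termination
  by (relation "measure (\<lambda>(A, f, w). deg_word w)") auto

definition ev_poly ::
    "('k::comm_ring_1, 'a, 'w) operated_alg \<Rightarrow> ('x \<Rightarrow> 'a) \<Rightarrow> ('w, 'x, 'k) bpoly \<Rightarrow> 'a" where
  "ev_poly A f p = (\<Oplus>\<^bsub>A\<^esub>w\<in>Poly_Mapping.keys p. Poly_Mapping.lookup p w \<odot>\<^bsub>A\<^esub> ev_word A f w)"

locale op_alg =
  fixes \<Omega> :: "'w set" and A :: "('k::comm_ring_1, 'a, 'w) operated_alg" (structure)
  assumes op_alg: "operated_algebra \<Omega> A"
begin

sublocale ring A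
  using op_alg by (simp add: operated_algebra_def)

sublocale smod: module coeff_ring A
  using op_alg by (simp add: operated_algebra_def)

lemma smult_closed: "a \<in> carrier A \<Longrightarrow> c \<odot> a \<in> carrier A"
  using smod.smult_closed[of c a] by simp

lemma smult_add_left: "a \<in> carrier A \<Longrightarrow> (c + d) \<odot> a = c \<odot> a \<oplus> d \<odot> a"
  using smod.smult_l_distr[of c d a] by simp

lemma smult_add_right: "a \<in> carrier A \<Longrightarrow> b \<in> carrier A \<Longrightarrow> c \<odot> (a \<oplus> b) = c \<odot> a \<oplus> c \<odot> b"
  using smod.smult_r_distr[of c a b] by simp

lemma smult_smult: "a \<in> carrier A \<Longrightarrow> c \<odot> (d \<odot> a) = (c * d) \<odot> a"
  using smod.smult_assoc1[of c d a] by simp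

lemma smult_1: "a \<in> carrier A \<Longrightarrow> 1 \<odot> a = a"
  using smod.smult_one[of a] by simp

lemma smult_0: "a \<in> carrier A \<Longrightarrow> 0 \<odot> a = \<zero>" "c \<odot> \<zero> = \<zero>"
  using smod.smult_l_null[of a] smod.smult_r_null[of c] by simp_all

lemma smult_mult:
  "a \<in> carrier A \<Longrightarrow> b \<in> carrier A \<Longrightarrow> (c \<odot> a) \<otimes> b = c \<odot> (a \<otimes> b)"
  "a \<in> carrier A \<Longrightarrow> b \<in> carrier A \<Longrightarrow> a \<otimes> (c \<odot> b) = c \<odot> (a \<otimes> b)"
  using op_alg unfolding operated_algebra_def by blast+

lemma oper_closed: "\<omega> \<in> \<Omega> \<Longrightarrow> a \<in> carrier A \<Longrightarrow> oper A \<omega> a \<in> carrier A"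
  using op_alg unfolding operated_algebra_def by blast

lemma oper_add:
  "\<omega> \<in> \<Omega> \<Longrightarrow> a \<in> carrier A \<Longrightarrow> b \<in> carrier A \<Longrightarrow> oper A \<omega> (a \<oplus> b) = oper A \<omega> a \<oplus> oper A \<omega> b"
  using op_alg unfolding operated_algebra_def by blast

lemma oper_smult: "\<omega> \<in> \<Omega> \<Longrightarrow> a \<in> carrier A \<Longrightarrow> oper A \<omega> (c \<odot> a) = c \<odot> oper A \<omega> a"
  using op_alg unfolding operated_algebra_def by blast

lemma oper_zero: "\<omega> \<in> \<Omega> \<Longrightarrow> oper A \<omega> \<zero> = \<zero>"
  using oper_smult[of \<omega> "\<zero>" 0] by (simp add: smult_0 oper_closed)

lemma smult_minus_1: "a \<in> carrier A \<Longrightarrow> (- 1) \<odot> a = \<ominus> a"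
  using smult_add_left[of a "- 1" 1] minus_equality[of "(- 1) \<odot> a" a]
  by (simp add: smult_0 smult_1 smult_closed)

lemma oper_minus:
  assumes "\<omega> \<in> \<Omega>" "a \<in> carrier A" "b \<in> carrier A"
  shows "oper A \<omega> (a \<ominus> b) = oper A \<omega> a \<ominus> oper A \<omega> b"
  using assms oper_smult[of \<omega> b "- 1"] by (simp add: a_minus_def oper_add smult_minus_1 oper_closed)

lemma smult_minus:
  assumes "a \<in> carrier A" "b \<in> carrier A"
  shows "c \<odot> (a \<ominus> b) = c \<odot> a \<ominus> c \<odot> b"
  using assms smult_smult[of b c "- 1"] smult_smult[of b "- 1" c]
  by (simp add: a_minus_def smult_add_right smult_minus_1 smult_closed)

context
  fixes X :: "'x set" and f :: "'x \<Rightarrow> 'a"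
  assumes f: "f \<in> X \<rightarrow> carrier A"
begin

lemma ev_word_closed: "w \<in> bwords \<Omega> X \<Longrightarrow> ev_word A f w \<in> carrier A"
  by (induction w rule: word_induct) (use f in \<open>auto simp: oper_closed\<close>)

lemma ev_word_append:
  "u \<in> bwords \<Omega> X \<Longrightarrow> v \<in> bwords \<Omega> X \<Longrightarrow> ev_word A f (u @ v) = ev_word A f u \<otimes> ev_word A f v"
proof (induction u rule: word_induct)
  case (Letter x w)
  then have "f x \<in> carrier A"
    using f by auto
  with Letter show ?case
    by (simp add: ev_word_closed m_assoc)
qed (auto simp: ev_word_closed oper_closed m_assoc)

lemma ev_poly_superset:
  assumes "finite F" "Poly_Mapping.keys p \<subseteq> F" "F \<subseteq> bwords \<Omega> X"
  shows "ev_poly A f p = (\<Oplus>w\<in>F. Poly_Mapping.lookup p w \<odot> ev_word A f w)"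
  unfolding ev_poly_def using assms
  by (intro add.finprod_mono_neutral_cong_left) (auto simp: in_keys_iff smult_0 ev_word_closed smult_closed)

lemma ev_poly_closed: "p \<in> bpolys \<Omega> X \<Longrightarrow> ev_poly A f p \<in> carrier A"
  unfolding ev_poly_def bpolys_def
  by (intro finsum_closed) (auto intro!: smult_closed ev_word_closed)

lemma ev_poly_zero: "ev_poly A f 0 = \<zero>"
  by (simp add: ev_poly_def)

lemma ev_poly_single: "w \<in> bwords \<Omega> X \<Longrightarrow> ev_poly A f (Poly_Mapping.single w c) = c \<odot> ev_word A f w"
  by (subst ev_poly_superset[of "{w}"]) (auto simp: ev_word_closed smult_closed)

lemma ev_poly_add:
  assumes "p \<in> bpolys \<Omega> X" "q \<in> bpolys \<Omega> X"
  shows "ev_poly A f (p + q) = ev_poly A f p \<oplus> ev_poly A f q"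
proof -
  let ?F = "Poly_Mapping.keys p \<union> Poly_Mapping.keys q"
  have F: "?F \<subseteq> bwords \<Omega> X"
    using assms by (auto simp: bpolys_def)
  have "ev_poly A f (p + q) =
    (\<Oplus>w\<in>?F. Poly_Mapping.lookup p w \<odot> ev_word A f w \<oplus> Poly_Mapping.lookup q w \<odot> ev_word A f w)"
    using F keys_add[of p q]
    by (subst ev_poly_superset[of ?F])
      (auto simp: lookup_add smult_add_left ev_word_closed smult_closed intro!: finsum_cong')
  also have "\<dots> = ev_poly A f p \<oplus> ev_poly A f q"
    using F by (subst (1 2) ev_poly_superset[of ?F], auto)
      (auto intro!: finsum_addf smult_closed ev_word_closed)
  finally show ?thesis .
qed

lemma ev_poly_scale: "p \<in> bpolys \<Omega> X \<Longrightarrow> ev_poly A f (scale c p) = c \<odot> ev_poly A f p"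
  by (induction rule: bpolys_induct)
    (simp_all add: scale_simps ev_poly_zero ev_poly_single ev_poly_add ev_poly_closed bpolys_closed
      smult_0 smult_smult smult_add_right ev_word_closed)

lemma ev_poly_mult:
  assumes "p \<in> bpolys \<Omega> X" "q \<in> bpolys \<Omega> X"
  shows "ev_poly A f (p * q) = ev_poly A f p \<otimes> ev_poly A f q"
  using assms(1)
proof (induction rule: bpolys_induct)
  case (single u c)
  show ?case
    using assms(2) single
    by (induction rule: bpolys_induct)
      (simp_all add: ev_poly_zero ev_poly_single ev_poly_add ev_poly_closed bpolys_closed distrib_left
        mult_single plus_list_def ev_word_append ev_word_closed smult_mult smult_smult smult_closed r_distr mult.commute)
qed (simp_all add: assms ev_poly_zero ev_poly_add ev_poly_closed bpolys_closed distrib_right l_distr)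

lemma ev_poly_bracket:
  assumes "\<omega> \<in> \<Omega>" "p \<in> bpolys \<Omega> X"
  shows "ev_poly A f (bracket_lin \<omega> p) = oper A \<omega> (ev_poly A f p)"
  using assms(2)
  by (induction rule: bpolys_induct)
    (simp_all add: assms(1) bracket_lin_simps ev_poly_zero ev_poly_single ev_poly_add ev_poly_closed
      bpolys_closed oper_zero oper_smult oper_add oper_closed ev_word_closed)

lemma ev_poly_hom: "ev_poly A f \<in> operated_hom \<Omega> (bword_alg \<Omega> X) A"
proof -
  have "ev_poly A f 1 = \<one>"
    using ev_poly_single[of "[]" 1] by (simp add: smult_1)
  then show ?thesis
    unfolding operated_hom_def
    by (auto intro!: ring_hom_memI simp: ev_poly_closed ev_poly_mult ev_poly_add ev_poly_scale ev_poly_bracket)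
qed

end

text \<open>Every word arises from letters by products and brackets, so a homomorphism is determined
  by its values on letters. With \<open>ev_poly_hom\<close> this is the universal property of
  \<open>bword_alg\<close>.\<close>

lemma operated_hom_eq_ev_poly:
  assumes "\<phi> \<in> operated_hom \<Omega> (bword_alg \<Omega> X) A" "\<And>x. x \<in> X \<Longrightarrow> \<phi> (mono_elt [Letter x]) = f x"
    and "p \<in> bpolys \<Omega> X"
  shows "\<phi> p = ev_poly A f p"
proof -
  have \<phi>: "\<phi> p \<in> carrier A" "\<phi> (p * q) = \<phi> p \<otimes> \<phi> q" "\<phi> (p + q) = \<phi> p \<oplus> \<phi> q" "\<phi> 1 = \<one>"
    "\<phi> (scale c p) = c \<odot> \<phi> p" "\<omega> \<in> \<Omega> \<Longrightarrow> \<phi> (bracket_lin \<omega> p) = oper A \<omega> (\<phi> p)"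
    if "p \<in> bpolys \<Omega> X" "q \<in> bpolys \<Omega> X" for p q c \<omega>
    using assms(1) that unfolding operated_hom_def ring_hom_def by auto
  have f: "f \<in> X \<rightarrow> carrier A"
    by (auto simp flip: assms(2) intro!: \<phi>(1)[OF _ bpolys_closed(1)] bpolys_closed(8))
  have word: "\<phi> (mono_elt w) = ev_word A f w" if "w \<in> bwords \<Omega> X" for w
    using that
  proof (induction w rule: word_induct)
    case Nil
    then show ?case
      using \<phi>(4)[OF bpolys_closed(1,1)] by simp
  next
    case (Letter x w)
    have "mono_elt (Letter x # w) = mono_elt [Letter x] * (mono_elt w :: ('w, 'b, 'k) bpoly)"
      by (simp add: mono_elt_mult)
    with Letter show ?case
      using \<phi>(2)[of "mono_elt [Letter x]" "mono_elt w"] assms(2)[of x] by (simp add: bpolys_closed)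
  next
    case (Bracket \<omega> u w)
    have "mono_elt (Bracket \<omega> u # w) = bracket_lin \<omega> (mono_elt u) * (mono_elt w :: ('w, 'b, 'k) bpoly)"
      by (simp add: mono_elt_mult)
    with Bracket show ?case
      using \<phi>(2)[of "bracket_lin \<omega> (mono_elt u)" "mono_elt w"] \<phi>(6)[OF _ bpolys_closed(1), of "mono_elt u" \<omega>]
      by (simp add: bpolys_closed)
  qed
  \<comment> \<open>Preservation of zero is not among the defining clauses of
    \<open>ring_hom\<close>; here homogeneity with the scalar 0 gives it.\<close>
  have "\<phi> 0 = \<zero>"
    using \<phi>(5)[OF bpolys_closed(1,1), of 0] \<phi>(1)[OF bpolys_closed(1,1)] by (simp add: scale_simps smult_0)
  with assms(3) show ?thesis
  proof (induction rule: bpolys_induct)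
    case (single w c)
    then show ?case
      using \<phi>(5)[of "mono_elt w" 0 c] word[of w]
      by (simp add: ev_poly_single[OF f] bpolys_closed)
  qed (simp_all add: ev_poly_zero[OF f] ev_poly_add[OF f] \<phi>(3))
qed

end

section \<open>Quotients by operated ideals\<close>

lemma (in op_alg) gen_operated_ideal:
  assumes "S \<subseteq> carrier A"
  shows "operated_ideal \<Omega> A (gen_operated_ideal \<Omega> A S)" "S \<subseteq> gen_operated_ideal \<Omega> A S"
proof -
  have "operated_ideal \<Omega> A (carrier A)"
    by (auto simp: operated_ideal_def oneideal oper_closed)
  then have "ideal (gen_operated_ideal \<Omega> A S) A"
    unfolding gen_operated_ideal_def using assms
    by (intro i_Intersect) (auto simp: operated_ideal_def)
  then show "operated_ideal \<Omega> A (gen_operated_ideal \<Omega> A S)"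
    by (auto simp: operated_ideal_def gen_operated_ideal_def)
qed (auto simp: gen_operated_ideal_def)

locale op_ideal = op_alg +
  fixes I
  assumes op_ideal: "operated_ideal \<Omega> A I"
begin

sublocale ideal I A
  using op_ideal by (simp add: operated_ideal_def)

abbreviation Q where
  "Q \<equiv> quot_alg A I"

lemma coset_eq_iff:
  assumes "a \<in> carrier A" "b \<in> carrier A"
  shows "I +> a = I +> b \<longleftrightarrow> a \<ominus> b \<in> I"
  using a_rcos_module_minus[OF ring_axioms, of b a] a_repr_independence'[of a b]
    a_repr_independenceD[of a b] assms by metis

lemma coset_eq_I: "a \<in> carrier A \<Longrightarrow> I +> a = I \<longleftrightarrow> a \<in> I"
  using a_rcos_zero[OF ideal_axioms] rcos_const_imp_mem by metis

text \<open>The operations of \<open>quot_alg\<close> are unions over all representatives. The union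
  collapses to a single coset once the map respects congruence modulo \<open>I\<close>.\<close>

lemma induced_coset:
  assumes "a \<in> carrier A" "g \<in> carrier A \<rightarrow> carrier A"
    and "\<And>b. b \<in> carrier A \<Longrightarrow> b \<ominus> a \<in> I \<Longrightarrow> g b \<ominus> g a \<in> I"
  shows "(\<Union>b\<in>I +> a. I +> g b) = I +> g a"
proof -
  have "I +> g b = I +> g a" if "b \<in> I +> a" for b
  proof -
    have "b \<in> carrier A"
      using that a_elemrcos_carrier[OF assms(1)] by blast
    then show ?thesis
      using that a_rcos_module_minus[OF ring_axioms assms(1), of b] assms by (subst coset_eq_iff) auto
  qed
  moreover have "a \<in> I +> a"
    using assms(1) by (rule a_rcos_self)
  ultimately show ?thesis
    by blast
qed

text \<open>Acting by c is multiplication by c times the unit, so closure under products is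
  enough.\<close>

lemma smult_in_ideal: "a \<in> I \<Longrightarrow> c \<odot> a \<in> I"
  using I_l_closed[of a "c \<odot> \<one>"] by (simp add: smult_mult smult_closed a_Hcarr)

lemma oper_in_ideal: "\<omega> \<in> \<Omega> \<Longrightarrow> a \<in> I \<Longrightarrow> oper A \<omega> a \<in> I"
  using op_ideal by (simp add: operated_ideal_def)

lemma carrier_quot: "carrier Q = {I +> a | a. a \<in> carrier A}"
  by (auto simp: quot_alg_def FactRing_simps)

lemma coset_in_carrier [simp]: "a \<in> carrier A \<Longrightarrow> I +> a \<in> carrier Q"
  by (auto simp: carrier_quot)

lemma quot_simps:
  "a \<in> carrier A \<Longrightarrow> b \<in> carrier A \<Longrightarrow> (I +> a) \<otimes>\<^bsub>Q\<^esub> (I +> b) = I +> (a \<otimes> b)"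
  "a \<in> carrier A \<Longrightarrow> b \<in> carrier A \<Longrightarrow> (I +> a) \<oplus>\<^bsub>Q\<^esub> (I +> b) = I +> (a \<oplus> b)"
  "\<one>\<^bsub>Q\<^esub> = I +> \<one>" "\<zero>\<^bsub>Q\<^esub> = I"
  "a \<in> carrier A \<Longrightarrow> c \<odot>\<^bsub>Q\<^esub> (I +> a) = I +> (c \<odot> a)"
  "\<omega> \<in> \<Omega> \<Longrightarrow> a \<in> carrier A \<Longrightarrow> oper Q \<omega> (I +> a) = I +> oper A \<omega> a"
proof -
  show "c \<odot>\<^bsub>Q\<^esub> (I +> a) = I +> (c \<odot> a)" if "a \<in> carrier A" for c a
  proof -
    have "c \<odot> b \<ominus> c \<odot> a \<in> I" if "b \<in> carrier A" "b \<ominus> a \<in> I" for b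
      using smult_in_ideal[OF that(2), of c] that \<open>a \<in> carrier A\<close> by (simp add: smult_minus)
    then have "(\<Union>b\<in>I +> a. I +> (c \<odot> b)) = I +> (c \<odot> a)"
      using that by (intro induced_coset) (auto simp: smult_closed)
    then show ?thesis
      by (simp add: quot_alg_def)
  qed
  show "oper Q \<omega> (I +> a) = I +> oper A \<omega> a" if "\<omega> \<in> \<Omega>" "a \<in> carrier A" for \<omega> a
  proof -
    have "oper A \<omega> b \<ominus> oper A \<omega> a \<in> I" if "b \<in> carrier A" "b \<ominus> a \<in> I" for b
      using oper_in_ideal[OF \<open>\<omega> \<in> \<Omega>\<close> that(2)] that \<open>\<omega> \<in> \<Omega>\<close> \<open>a \<in> carrier A\<close> by (simp add: oper_minus)
    then have "(\<Union>b\<in>I +> a. I +> oper A \<omega> b) = I +> oper A \<omega> a"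
      using that by (intro induced_coset) (auto simp: oper_closed)
    then show ?thesis
      by (simp add: quot_alg_def)
  qed
qed (simp_all add: quot_alg_def FactRing_def rcoset_mult_add a_rcos_sum)

lemma operated_quot: "operated_algebra \<Omega> Q"
proof -
  have zero: "\<zero>\<^bsub>Q\<^esub> = I +> \<zero>"
    using coset_eq_I[of \<zero>] by (simp add: quot_simps)
  note closed = smult_closed oper_closed
  have ag: "abelian_group Q"
  proof (rule abelian_groupI)
    show "\<exists>D\<in>carrier Q. D \<oplus>\<^bsub>Q\<^esub> C = \<zero>\<^bsub>Q\<^esub>" if C: "C \<in> carrier Q" for C
    proof -
      obtain a where "C = I +> a" "a \<in> carrier A"
        using C by (auto simp: carrier_quot)
      then show ?thesis
        by (intro bexI[of _ "I +> (\<ominus> a)"]) (simp_all add: quot_simps(2) zero l_neg)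
    qed
  qed (auto simp: carrier_quot quot_simps(2) zero a_ac)
  moreover have "Group.monoid Q"
    by (rule monoidI) (auto simp: carrier_quot quot_simps(1,3) m_assoc)
  ultimately have "ring Q"
    by (intro ringI) (auto simp: carrier_quot quot_simps(1-3) l_distr r_distr)
  moreover have "module coeff_ring Q"
    by (intro moduleI cring_coeff_ring ag)
      (auto simp: carrier_quot quot_simps(2,5) closed smult_add_left smult_add_right smult_smult smult_1)
  moreover have "(c \<odot>\<^bsub>Q\<^esub> C) \<otimes>\<^bsub>Q\<^esub> D = c \<odot>\<^bsub>Q\<^esub> (C \<otimes>\<^bsub>Q\<^esub> D)" "C \<otimes>\<^bsub>Q\<^esub> (c \<odot>\<^bsub>Q\<^esub> D) = c \<odot>\<^bsub>Q\<^esub> (C \<otimes>\<^bsub>Q\<^esub> D)"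
    if "C \<in> carrier Q" "D \<in> carrier Q" for C D c
    using that by (auto simp: carrier_quot quot_simps(1,5) closed smult_mult)
  moreover have "oper Q \<omega> C \<in> carrier Q" "oper Q \<omega> (C \<oplus>\<^bsub>Q\<^esub> D) = oper Q \<omega> C \<oplus>\<^bsub>Q\<^esub> oper Q \<omega> D"
    "oper Q \<omega> (c \<odot>\<^bsub>Q\<^esub> C) = c \<odot>\<^bsub>Q\<^esub> oper Q \<omega> C"
    if "\<omega> \<in> \<Omega>" "C \<in> carrier Q" "D \<in> carrier Q" for C D c \<omega>
    using that by (auto simp: carrier_quot quot_simps(2,5,6) closed oper_add oper_smult)
  ultimately show ?thesis
    unfolding operated_algebra_def by (intro conjI ballI allI funcsetI) auto
qed

sublocale quot: op_alg \<Omega> Q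
  by unfold_locales (rule operated_quot)

lemma quot_hom: "(\<lambda>a. I +> a) \<in> operated_hom \<Omega> A Q"
  unfolding operated_hom_def by (auto intro!: ring_hom_memI simp: quot_simps)

lemma finsum_coset:
  assumes "finite F" "g \<in> F \<rightarrow> carrier A"
  shows "(\<Oplus>\<^bsub>Q\<^esub>j\<in>F. I +> g j) = I +> (\<Oplus>j\<in>F. g j)"
  using assms
proof (induction F)
  case empty
  then show ?case
    using coset_eq_I[of \<zero>] by (simp add: quot_simps)
next
  case (insert j F)
  then have "g \<in> F \<rightarrow> carrier A" "g j \<in> carrier A"
    by auto
  with insert show ?case
    by (simp add: quot_simps Pi_def)
qed

text \<open>The value on a coset is read off a chosen representative, and the choice does not matter
  because \<open>I\<close> is killed. Restricting to the carrier makes the map extensional, as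
  uniqueness in the definition of freeness requires.\<close>

lemma hom_factors:
  assumes "\<psi> \<in> operated_hom \<Omega> A B" "op_alg \<Omega> B" "\<And>a. a \<in> I \<Longrightarrow> \<psi> a = \<zero>\<^bsub>B\<^esub>"
  obtains \<phi> where "\<phi> \<in> operated_hom \<Omega> Q B" "\<phi> \<in> extensional (carrier Q)"
    "\<And>a. a \<in> carrier A \<Longrightarrow> \<phi> (I +> a) = \<psi> a"
proof -
  interpret B: op_alg \<Omega> B
    by fact
  interpret \<psi>: ring_hom_ring A B \<psi>
    using assms(1) by (intro ring_hom_ringI2) (auto simp: operated_hom_def ring_axioms B.ring_axioms)
  define \<phi> where "\<phi> = restrict (\<lambda>C. \<psi> (SOME a. a \<in> carrier A \<and> C = I +> a)) (carrier Q)"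
  have \<phi>: "\<phi> (I +> a) = \<psi> a" if "a \<in> carrier A" for a
  proof -
    define b where "b = (SOME b. b \<in> carrier A \<and> I +> a = I +> b)"
    have b: "b \<in> carrier A" "I +> a = I +> b"
      using someI[of "\<lambda>b. b \<in> carrier A \<and> I +> a = I +> b" a] that by (auto simp: b_def)
    then have "\<psi> (a \<ominus> b) = \<zero>\<^bsub>B\<^esub>"
      using assms(3) that by (simp add: coset_eq_iff)
    then have "\<psi> b = \<psi> a"
      using that b B.minus_equality[of "\<psi> a" "\<ominus>\<^bsub>B\<^esub> \<psi> b"] by (simp add: a_minus_def)
    then show ?thesis
      using that by (simp add: \<phi>_def b_def)
  qed
  show ?thesis
  proof
    show "\<phi> \<in> operated_hom \<Omega> Q B"
      using assms(1) unfolding operated_hom_def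
      by (auto intro!: ring_hom_memI simp: carrier_quot quot_simps \<phi> smult_closed oper_closed)
    show "\<phi> \<in> extensional (carrier Q)"
      by (simp add: \<phi>_def)
  qed (rule \<phi>)
qed

end

section \<open>The Rota-Baxter product on bracketed words\<close>

text \<open>
  The product is defined on all words, not only on the reduced ones: adjacent brackets inside a
  factor are left alone, and associativity then needs no side condition.
\<close>

function rb_prod :: "('w \<Rightarrow> 'k) \<Rightarrow> ('w, 'x) word \<Rightarrow> ('w, 'x) word \<Rightarrow> ('w, 'x, 'k::comm_ring_1) bpoly" where
  "rb_prod lam u v =
    (if u = [] \<or> v = [] then mono_elt (u @ v)
     else case (last u, hd v) of
       (Bracket \<alpha> a, Bracket \<beta> b) \<Rightarrow> mono_elt (butlast u)
         * (bracket_lin \<beta> (rb_prod lam [Bracket \<alpha> a] b) + bracket_lin \<alpha> (rb_prod lam a [Bracket \<beta> b])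
            + scale (lam \<beta>) (bracket_lin \<alpha> (rb_prod lam a b)))
         * mono_elt (tl v)
     | _ \<Rightarrow> mono_elt (u @ v))"
  by pat_completeness auto
termination
proof (relation "measure (\<lambda>(lam, u, v). deg_word u + deg_word v)")
  fix u v :: "('w, 'x) word" and lam \<alpha> a \<beta> b x y
  assume "\<not> (u = [] \<or> v = [])" "(x, y) = (last u, hd v)" "x = Bracket \<alpha> a" "y = Bracket \<beta> b"
  then have "u = butlast u @ [Bracket \<alpha> a]" "v = Bracket \<beta> b # tl v"
    by (metis append_butlast_last_id prod.inject, metis list.collapse prod.inject)
  then have "deg_word u = deg_word (butlast u @ [Bracket \<alpha> a])" "deg_word v = deg_word (Bracket \<beta> b # tl v)"
    by presburger+
  then show "((lam, [Bracket \<alpha> a], b), lam, u, v) \<in> measure (\<lambda>(lam, u, v). deg_word u + deg_word v)"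
    "((lam, a, [Bracket \<beta> b]), lam, u, v) \<in> measure (\<lambda>(lam, u, v). deg_word u + deg_word v)"
    "((lam, a, b), lam, u, v) \<in> measure (\<lambda>(lam, u, v). deg_word u + deg_word v)"
    by auto
qed auto

declare rb_prod.simps [simp del]

lemma rb_prod_Nil [simp]: "rb_prod lam [] v = mono_elt v" "rb_prod lam u [] = mono_elt u"
  by (subst rb_prod.simps; simp)+

lemma rb_prod_Letter [simp]:
  "rb_prod lam (u @ [Letter x]) v = mono_elt (u @ Letter x # v)"
  "rb_prod lam [Letter x] v = mono_elt (Letter x # v)"
  "rb_prod lam u (Letter x # v) = mono_elt (u @ Letter x # v)"
  by (subst rb_prod.simps; simp split: prime_word.split)+

lemma rb_prod_Bracket:
  "rb_prod lam (u @ [Bracket \<alpha> a]) (Bracket \<beta> b # v) = mono_elt u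
    * (bracket_lin \<beta> (rb_prod lam [Bracket \<alpha> a] b) + bracket_lin \<alpha> (rb_prod lam a [Bracket \<beta> b])
      + scale (lam \<beta>) (bracket_lin \<alpha> (rb_prod lam a b))) * mono_elt v"
  by (subst rb_prod.simps) simp

text \<open>The cases, which may overlap, look only at the junction of the two words. The
  \<diamond>-product differs from concatenation in the last one alone.\<close>

lemma words_cases:
  fixes u v :: "('w, 'x) word"
  obtains (Nil1) "u = []" | (Nil2) "v = []" | (Letter1) u' x where "u = u' @ [Letter x]"
  | (Letter2) x v' where "v = Letter x # v'"
  | (Brackets) u' \<alpha> a \<beta> b v' where "u = u' @ [Bracket \<alpha> a]" "v = Bracket \<beta> b # v'"
  by (metis list.exhaust prime_word.exhaust rev_exhaust)

text \<open>Only the last factor of the left word takes part in the recursion, so a prefix passes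
  through. For empty \<open>u\<close> that factor would belong to \<open>p\<close>, hence the
  assumption.\<close>

lemma rb_prod_append1: "u \<noteq> [] \<Longrightarrow> rb_prod lam (p @ u) v = mono_elt p * rb_prod lam u v"
  by (cases rule: words_cases[where u = u and v = v])
    (simp_all add: mono_elt_mult rb_prod_Bracket mult.assoc flip: append_assoc,
      simp_all flip: mono_elt_mult add: mult.assoc)

lemma rb_prod_append2: "v \<noteq> [] \<Longrightarrow> rb_prod lam u (v @ s) = rb_prod lam u v * mono_elt s"
  by (cases rule: words_cases[where u = u and v = v])
    (simp_all add: mono_elt_mult rb_prod_Bracket mult.assoc)

text \<open>Pulling a word out of a \<diamond>-product of polynomials requires that the empty word
  does not occur in the adjacent factor (\<open>rb_prod_lin_mult_mono\<close>). Products qualify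
  because every term created at a junction of brackets again contains a bracket.\<close>

lemma keys_rb_prod_nonempty:
  fixes u v :: "('w, 'x) word" and lam :: "'w \<Rightarrow> 'k::comm_ring_1"
  shows "u \<noteq> [] \<or> v \<noteq> [] \<Longrightarrow> [] \<notin> Poly_Mapping.keys (rb_prod lam u v)"
proof (cases rule: words_cases[where u = u and v = v])
  case (Brackets u' \<alpha> a \<beta> b v')
  define x where "x = bracket_lin \<beta> (rb_prod lam [Bracket \<alpha> a] b) + bracket_lin \<alpha> (rb_prod lam a [Bracket \<beta> b])
      + scale (lam \<beta>) (bracket_lin \<alpha> (rb_prod lam a b))"
  have *: "Poly_Mapping.keys (bracket_lin \<omega> y) \<subseteq> - {[]}" for \<omega> and y :: "('w, 'x, 'k) bpoly"
    using keys_bracket_lin[of y UNIV \<omega>] by auto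
  have "Poly_Mapping.keys x \<subseteq> - {[]}"
    unfolding x_def by (intro keys_add_subset order.trans[OF keys_scale] *)
  then have "Poly_Mapping.keys (mono_elt u' * x) \<subseteq> - {[]}"
    using keys_mult[of "mono_elt u'" x] by (auto simp: plus_list_def)
  then have "Poly_Mapping.keys (mono_elt u' * x * mono_elt v') \<subseteq> - {[]}"
    using keys_mult[of "mono_elt u' * x" "mono_elt v'"] by (auto simp: plus_list_def)
  then show ?thesis
    by (auto simp: Brackets rb_prod_Bracket x_def)
qed auto

lemma scale_commute: "scale (c * d) f = scale (d * c) f"
  by (simp only: mult.commute[of c d])

section \<open>Bilinear extension of the product and its associativity\<close>

definition rb_prod_lin ::
    "('w \<Rightarrow> 'k) \<Rightarrow> ('w, 'x, 'k::comm_ring_1) bpoly \<Rightarrow> ('w, 'x, 'k) bpoly \<Rightarrow> ('w, 'x, 'k) bpoly" where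
  "rb_prod_lin lam f g = word_lin_ext (\<lambda>u. word_lin_ext (\<lambda>v. rb_prod lam u v) g) f"

lemma rb_prod_lin_simps:
  "rb_prod_lin lam 0 g = 0" "rb_prod_lin lam (f + f') g = rb_prod_lin lam f g + rb_prod_lin lam f' g"
  "rb_prod_lin lam (scale c f) g = scale c (rb_prod_lin lam f g)"
  "rb_prod_lin lam f 0 = 0" "rb_prod_lin lam f (g + g') = rb_prod_lin lam f g + rb_prod_lin lam f g'"
  "rb_prod_lin lam f (scale c g) = scale c (rb_prod_lin lam f g)"
proof -
  show "rb_prod_lin lam f 0 = 0"
    by (simp add: rb_prod_lin_def word_lin_ext_def scale_simps)
  show "rb_prod_lin lam f (g + g') = rb_prod_lin lam f g + rb_prod_lin lam f g'"
    by (simp add: rb_prod_lin_def word_lin_ext_add) (simp add: word_lin_ext_def scale_simps sum.distrib)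
  show "rb_prod_lin lam f (scale c g) = scale c (rb_prod_lin lam f g)"
    by (induction f rule: poly_mapping_induct)
      (simp_all add: rb_prod_lin_def word_lin_ext_simps scale_simps scale_commute)
qed (simp_all add: rb_prod_lin_def word_lin_ext_simps)

lemma rb_prod_lin_single:
  "rb_prod_lin lam (Poly_Mapping.single u c) (Poly_Mapping.single v d) = scale (c * d) (rb_prod lam u v)"
  by (simp add: rb_prod_lin_def word_lin_ext_simps scale_simps)

lemma rb_prod_lin_mono [simp]: "rb_prod_lin lam (mono_elt u) (mono_elt v) = rb_prod lam u v"
  by (simp add: rb_prod_lin_single scale_simps)

lemma bpoly_linear_induct [case_names zero mono add scale]:
  fixes f :: "('w, 'x, 'k::comm_ring_1) bpoly"
  assumes "P 0" "\<And>w. P (mono_elt w)" "\<And>f g. P f \<Longrightarrow> P g \<Longrightarrow> P (f + g)" "\<And>c f. P f \<Longrightarrow> P (scale c f)"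
  shows "P f"
proof (induction f rule: poly_mapping_induct)
  case (single w c)
  then show ?case
    using assms(4)[OF assms(2), of c w] by simp
qed (use assms in auto)

lemma rb_prod_lin_1 [simp]: "rb_prod_lin lam 1 f = f" "rb_prod_lin lam f 1 = f"
proof -
  have "rb_prod_lin lam (mono_elt []) f = f" "rb_prod_lin lam f (mono_elt []) = f"
    by (induction f rule: bpoly_linear_induct; simp add: rb_prod_lin_simps del: mono_elt_Nil)+
  then show "rb_prod_lin lam 1 f = f" "rb_prod_lin lam f 1 = f"
    by simp_all
qed

text \<open>At two words this is the defining recursion with empty outer parts, and both sides are
  bilinear. It is the matching Rota-Baxter identity for \<diamond>.\<close>

lemma rb_prod_lin_Bracket:
  "rb_prod_lin lam (bracket_lin \<alpha> f) (bracket_lin \<beta> g) =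
    bracket_lin \<beta> (rb_prod_lin lam (bracket_lin \<alpha> f) g) + bracket_lin \<alpha> (rb_prod_lin lam f (bracket_lin \<beta> g))
    + scale (lam \<beta>) (bracket_lin \<alpha> (rb_prod_lin lam f g))"
proof (induction f rule: bpoly_linear_induct)
  case (mono u)
  show ?case
  proof (induction g rule: bpoly_linear_induct)
    case (mono v)
    show ?case
      using rb_prod_Bracket[of lam "[]" \<alpha> u \<beta> v "[]"] by simp
  qed (simp_all add: rb_prod_lin_simps bracket_lin_simps scale_simps scale_commute add_ac)
qed (simp_all add: rb_prod_lin_simps bracket_lin_simps scale_simps scale_commute add_ac)

lemma rb_prod_lin_append_word:
  "u \<noteq> [] \<Longrightarrow> rb_prod_lin lam (mono_elt (p @ u)) g = mono_elt p * rb_prod_lin lam (mono_elt u) g"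
  "v \<noteq> [] \<Longrightarrow> rb_prod_lin lam g (mono_elt (v @ s)) = rb_prod_lin lam g (mono_elt v) * mono_elt s"
  by (induction g rule: bpoly_linear_induct;
    simp add: rb_prod_lin_simps rb_prod_append1 rb_prod_append2 scale_mult distrib_left distrib_right)+

lemma rb_prod_lin_mult_mono:
  assumes "[] \<notin> Poly_Mapping.keys f"
  shows "rb_prod_lin lam (mono_elt p * f) g = mono_elt p * rb_prod_lin lam f g"
    and "rb_prod_lin lam g (f * mono_elt s) = rb_prod_lin lam g f * mono_elt s"
proof -
  have f: "Poly_Mapping.keys f \<subseteq> - {[]}"
    using assms by auto
  show "rb_prod_lin lam (mono_elt p * f) g = mono_elt p * rb_prod_lin lam f g"
    using f
  proof (induction rule: poly_mapping_keys_induct)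
    case (single w c)
    then show ?case
      unfolding single_eq_scale[of w c] scale_mult rb_prod_lin_simps mono_elt_mult
      by (simp add: rb_prod_lin_append_word)
  qed (simp_all add: rb_prod_lin_simps distrib_left)
  show "rb_prod_lin lam g (f * mono_elt s) = rb_prod_lin lam g f * mono_elt s"
    using f
  proof (induction rule: poly_mapping_keys_induct)
    case (single w c)
    then show ?case
      unfolding single_eq_scale[of w c] scale_mult rb_prod_lin_simps mono_elt_mult
      by (simp add: rb_prod_lin_append_word)
  qed (simp_all add: rb_prod_lin_simps distrib_right)
qed

lemma rb_prod_lin_mult_word:
  assumes "v \<noteq> []"
  shows "rb_prod_lin lam (f * mono_elt v) (mono_elt w) = f * rb_prod lam v w"
    and "rb_prod_lin lam (mono_elt w) (mono_elt v * f) = rb_prod lam w v * f"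
  using assms
  by (induction f rule: bpoly_linear_induct;
    simp add: rb_prod_lin_simps rb_prod_append1 rb_prod_append2 scale_mult distrib_left distrib_right mono_elt_mult)+

lemma rb_prod_lin_Letter:
  "rb_prod_lin lam (mono_elt [Letter x]) f = mono_elt [Letter x] * f"
  "rb_prod_lin lam f (mono_elt [Letter x]) = f * mono_elt [Letter x]"
  by (induction f rule: bpoly_linear_induct;
    simp add: rb_prod_lin_simps scale_mult distrib_left distrib_right mono_elt_mult)+

text \<open>The seven hypotheses are associativity for the seven triples obtained by removing at
  least one of the three brackets. Expanding both sides of the conclusion leads to exactly these
  triples, all of smaller degree when the arguments are words.\<close>

lemma rb_prod_lin_assoc_brackets:
  assumes "rb_prod_lin lam (rb_prod_lin lam (bracket_lin \<alpha> x) (bracket_lin \<beta> y)) z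
      = rb_prod_lin lam (bracket_lin \<alpha> x) (rb_prod_lin lam (bracket_lin \<beta> y) z)"
    and "rb_prod_lin lam (rb_prod_lin lam x (bracket_lin \<beta> y)) (bracket_lin \<gamma> z)
      = rb_prod_lin lam x (rb_prod_lin lam (bracket_lin \<beta> y) (bracket_lin \<gamma> z))"
    and "rb_prod_lin lam (rb_prod_lin lam (bracket_lin \<alpha> x) y) (bracket_lin \<gamma> z)
      = rb_prod_lin lam (bracket_lin \<alpha> x) (rb_prod_lin lam y (bracket_lin \<gamma> z))"
    and "rb_prod_lin lam (rb_prod_lin lam (bracket_lin \<alpha> x) y) z = rb_prod_lin lam (bracket_lin \<alpha> x) (rb_prod_lin lam y z)"
    and "rb_prod_lin lam (rb_prod_lin lam x (bracket_lin \<beta> y)) z = rb_prod_lin lam x (rb_prod_lin lam (bracket_lin \<beta> y) z)"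
    and "rb_prod_lin lam (rb_prod_lin lam x y) (bracket_lin \<gamma> z) = rb_prod_lin lam x (rb_prod_lin lam y (bracket_lin \<gamma> z))"
    and "rb_prod_lin lam (rb_prod_lin lam x y) z = rb_prod_lin lam x (rb_prod_lin lam y z)"
  shows "rb_prod_lin lam (rb_prod_lin lam (bracket_lin \<alpha> x) (bracket_lin \<beta> y)) (bracket_lin \<gamma> z)
    = rb_prod_lin lam (bracket_lin \<alpha> x) (rb_prod_lin lam (bracket_lin \<beta> y) (bracket_lin \<gamma> z))"
proof -
  \<comment> \<open>The first hypothesis expands to three terms on its left. Solved for one of them
    it becomes a rewrite rule, and the two terms it subtracts cancel against the expansion of the
    conclusion.\<close>
  have *: "rb_prod_lin lam (bracket_lin \<beta> (rb_prod_lin lam (bracket_lin \<alpha> x) y)) z =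
    rb_prod_lin lam (bracket_lin \<alpha> x) (rb_prod_lin lam (bracket_lin \<beta> y) z)
    - rb_prod_lin lam (bracket_lin \<alpha> (rb_prod_lin lam x (bracket_lin \<beta> y))) z
    - scale (lam \<beta>) (rb_prod_lin lam (bracket_lin \<alpha> (rb_prod_lin lam x y)) z)"
    using assms(1) unfolding rb_prod_lin_Bracket rb_prod_lin_simps by (simp add: algebra_simps)
  show ?thesis
    by (simp add: assms(2-)[unfolded rb_prod_lin_Bracket] * rb_prod_lin_Bracket rb_prod_lin_simps bracket_lin_simps scale_simps
        scale_commute)
qed

text \<open>A word of breadth at least two keeps its two ends apart, so only the case of three brackets
  needs the relation.\<close>

lemma rb_prod_assoc:
  fixes u v w :: "('w, 'x) word"
  shows "rb_prod_lin lam (rb_prod lam u v) (mono_elt w) = rb_prod_lin lam (mono_elt u) (rb_prod lam v w)"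
proof (induction "deg_word u + deg_word v + deg_word w" arbitrary: u v w rule: less_induct)
  case less
  show ?case
  proof (cases "u = [] \<or> v = [] \<or> w = []")
    case True
    then show ?thesis
      by (auto simp del: mono_elt_Nil) (auto)
  next
    case False
    \<comment> \<open>Only the last factor of \<open>u\<close> and the first factor of
      \<open>w\<close> can interact with \<open>v\<close>; the outer parts \<open>u'\<close> and
      \<open>w'\<close> are multiplied back at the end.\<close>
    then obtain u' p r w' where u: "u = u' @ [p]" and w: "w = [r] @ w'"
      by (metis append_Cons append_Nil list.exhaust rev_exhaust)
    have nonempty: "[] \<notin> Poly_Mapping.keys (rb_prod lam [p] v)" "[] \<notin> Poly_Mapping.keys (rb_prod lam v [r])"
      by (simp_all add: keys_rb_prod_nonempty)
    have "rb_prod_lin lam (rb_prod lam [p] v) (mono_elt [r]) = rb_prod_lin lam (mono_elt [p]) (rb_prod lam v [r])"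
    proof -
      obtain s v' where v: "v = s # v'"
        using False by (cases v) auto
      show ?thesis
      proof (cases "v' = []")
        case False
        have "rb_prod lam [p] (s # v') = rb_prod lam [p] [s] * mono_elt v'"
          "rb_prod lam (s # v') [r] = mono_elt [s] * rb_prod lam v' [r]"
          using rb_prod_append2[of "[s]" lam "[p]" v'] rb_prod_append1[of v' lam "[s]" "[r]"] False by auto
        then show ?thesis
          using False by (simp add: v rb_prod_lin_mult_word)
      next
        case True
        show ?thesis
        proof (cases s)
          case (Letter x)
          then show ?thesis
            using rb_prod_append1[of "[Letter x]" lam "[p]" "[r]"] rb_prod_append2[of "[Letter x]" lam "[p]" "[r]"] v True
            by (simp add: mono_elt_mult)
        next
          case s: (Bracket \<beta> b)
          show ?thesis
          proof (cases p)
            case (Letter x)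
            then show ?thesis
              using rb_prod_append1[of v lam "[p]" "[r]"] v by (simp add: rb_prod_lin_Letter)
          next
            case p: (Bracket \<alpha> a)
            show ?thesis
            proof (cases r)
              case (Letter x)
              then show ?thesis
                using rb_prod_append2[of v lam "[p]" "[r]"] v by (simp add: rb_prod_lin_Letter)
            next
              case r: (Bracket \<gamma> c)
              \<comment> \<open>Three brackets contribute 3 to the degree, and \<open>u'\<close> and
                \<open>w'\<close> can only add to it. So every triple with a bracket removed is
                within reach of the induction hypothesis.\<close>
              have IH: "rb_prod_lin lam (rb_prod lam u0 v0) (mono_elt w0) = rb_prod_lin lam (mono_elt u0) (rb_prod lam v0 w0)"
                if "deg_word u0 + deg_word v0 + deg_word w0 < deg_word a + deg_word b + deg_word c + 3" for u0 v0 w0 :: "('w, 'x) word"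
                by (rule less) (use that in \<open>simp add: u v w p s r\<close>)
              show ?thesis
                using rb_prod_lin_assoc_brackets[of lam \<alpha> "mono_elt a" \<beta> "mono_elt b" "mono_elt c" \<gamma>]
                by (simp add: IH p s r v True)
            qed
          qed
        qed
      qed
    qed
    then show ?thesis
      using nonempty unfolding u w
      by (simp add: rb_prod_append1 rb_prod_append2[of "[r]" lam _ w', simplified] rb_prod_lin_mult_mono
          rb_prod_lin_append_word(1)[of "[p]"] rb_prod_lin_append_word(2)[of "[r]" _ _ w', simplified] mult.assoc)
  qed
qed

lemma rb_prod_lin_assoc: "rb_prod_lin lam (rb_prod_lin lam f g) h = rb_prod_lin lam f (rb_prod_lin lam g h)"
proof (induction f rule: bpoly_linear_induct)
  case (mono u)
  show ?case
  proof (induction g rule: bpoly_linear_induct)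
    case (mono v)
    show ?case
      by (induction h rule: bpoly_linear_induct) (simp_all add: rb_prod_lin_simps rb_prod_assoc)
  qed (simp_all add: rb_prod_lin_simps)
qed (simp_all add: rb_prod_lin_simps)

definition rb_prod_alg :: "('w \<Rightarrow> 'k) \<Rightarrow> ('k::comm_ring_1, ('w, 'x, 'k) bpoly, 'w) operated_alg" where
  "rb_prod_alg lam = \<lparr>carrier = UNIV, monoid.mult = rb_prod_lin lam, one = 1, zero = 0, add = (+),
     smult = scale, oper = bracket_lin\<rparr>"

lemma rb_prod_alg_simps [simp]:
  "carrier (rb_prod_alg lam) = UNIV" "f \<otimes>\<^bsub>rb_prod_alg lam\<^esub> g = rb_prod_lin lam f g" "\<one>\<^bsub>rb_prod_alg lam\<^esub> = 1"
  "\<zero>\<^bsub>rb_prod_alg lam\<^esub> = 0" "f \<oplus>\<^bsub>rb_prod_alg lam\<^esub> g = f + g" "c \<odot>\<^bsub>rb_prod_alg lam\<^esub> f = scale c f"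
  "oper (rb_prod_alg lam) = bracket_lin"
  by (simp_all add: rb_prod_alg_def)

lemma matching_rb_prod_alg: "matching_rota_baxter \<Omega> lam (rb_prod_alg lam)"
proof -
  have "operated_algebra \<Omega> (rb_prod_alg lam)"
    unfolding rb_prod_alg_def by (rule operated_algebra_bpolyI) (simp_all add: rb_prod_lin_simps rb_prod_lin_assoc)
  then show ?thesis
    unfolding matching_rota_baxter_def by (simp add: rb_prod_lin_Bracket)
qed

section \<open>Irreducible words\<close>

function reduced :: "('w, 'x) word \<Rightarrow> bool" where
  "reduced [] \<longleftrightarrow> True"
| "reduced (Letter x # w) \<longleftrightarrow> reduced w"
| "reduced (Bracket \<omega> u # w) \<longleftrightarrow> reduced u \<and> reduced w \<and> (\<nexists>\<beta> v w'. w = Bracket \<beta> v # w')"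
  by pat_completeness auto
termination
  by (relation "measure deg_word") auto

lemma reduced_append:
  "reduced (u @ v) \<longleftrightarrow> reduced u \<and> reduced v \<and> (\<nexists>u' \<alpha> a \<beta> b v'. u = u' @ [Bracket \<alpha> a] \<and> v = Bracket \<beta> b # v')"
  by (induction u rule: word_induct) (auto simp: Cons_eq_append_conv append_eq_Cons_conv)

lemma not_reduced_subst:
  "q \<in> star_words \<Omega> X \<Longrightarrow> \<not> reduced (subst_word [Bracket \<alpha> u, Bracket \<beta> v] q)"
  by (induction rule: star_words_induct) (auto simp: reduced_append)

lemma not_reduced_obtain:
  "w \<in> bwords \<Omega> X \<Longrightarrow> \<not> reduced w \<Longrightarrow> \<exists>q \<alpha> u \<beta> v. q \<in> star_words \<Omega> X \<and> \<alpha> \<in> \<Omega> \<and> \<beta> \<in> \<Omega> \<and>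
    u \<in> bwords \<Omega> X \<and> v \<in> bwords \<Omega> X \<and> w = subst_word [Bracket \<alpha> u, Bracket \<beta> v] q"
proof (induction w rule: word_induct)
  case (Letter x w)
  then obtain q \<alpha> u \<beta> v where "q \<in> star_words \<Omega> X" "\<alpha> \<in> \<Omega>" "\<beta> \<in> \<Omega>" "u \<in> bwords \<Omega> X" "v \<in> bwords \<Omega> X"
    "w = subst_word [Bracket \<alpha> u, Bracket \<beta> v] q"
    by auto
  then show ?case
    using concat_in_star_words[of q \<Omega> X "[Letter x]" "[]"] Letter.prems
    by (intro exI[of _ "emb [Letter x] @ q @ emb []"] exI[of _ \<alpha>] exI[of _ u] exI[of _ \<beta>] exI[of _ v]) simp
next
  case (Bracket \<omega> a w)
  have bw: "\<omega> \<in> \<Omega>" "a \<in> bwords \<Omega> X" "w \<in> bwords \<Omega> X"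
    using Bracket.prems by auto
  consider "\<not> reduced a" | "\<not> reduced w" | \<beta> v w' where "w = Bracket \<beta> v # w'"
    using Bracket.prems by auto
  then show ?case
  proof cases
    case 1
    then obtain q \<alpha> u \<beta> v where "q \<in> star_words \<Omega> X" "\<alpha> \<in> \<Omega>" "\<beta> \<in> \<Omega>" "u \<in> bwords \<Omega> X" "v \<in> bwords \<Omega> X"
      "a = subst_word [Bracket \<alpha> u, Bracket \<beta> v] q"
      using Bracket.IH(1) bw by blast
    then show ?thesis
      using concat_in_star_words[of "[Bracket \<omega> q]" \<Omega> X "[]" w] bw
      by (intro exI[of _ "emb [] @ [Bracket \<omega> q] @ emb w"] exI[of _ \<alpha>] exI[of _ u] exI[of _ \<beta>] exI[of _ v]) simp
  next
    case 2
    then obtain q \<alpha> u \<beta> v where "q \<in> star_words \<Omega> X" "\<alpha> \<in> \<Omega>" "\<beta> \<in> \<Omega>" "u \<in> bwords \<Omega> X" "v \<in> bwords \<Omega> X"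
      "w = subst_word [Bracket \<alpha> u, Bracket \<beta> v] q"
      using Bracket.IH(2) bw by blast
    then show ?thesis
      using concat_in_star_words[of q \<Omega> X "[Bracket \<omega> a]" "[]"] bw
      by (intro exI[of _ "emb [Bracket \<omega> a] @ q @ emb []"] exI[of _ \<alpha>] exI[of _ u] exI[of _ \<beta>] exI[of _ v]) simp
  next
    case 3
    then show ?thesis
      using concat_in_star_words[of "[star]" \<Omega> X "[]" w'] bw
      by (intro exI[of _ "emb [] @ [star] @ emb w'"] exI[of _ \<omega>] exI[of _ a] exI[of _ \<beta>] exI[of _ v]) simp
  qed
qed simp

text \<open>The leading monomials of the relations are precisely the pairs of adjacent admissible
  brackets, and a context can place such a pair at any depth.\<close>

lemma (in db_ordered) irr_eq_reduced: "irr \<Omega> X ord (S_M \<Omega> X lam) = {w \<in> bwords \<Omega> X. reduced w}"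
proof (rule subset_antisym; rule subsetI)
  fix w assume w: "w \<in> irr \<Omega> X ord (S_M \<Omega> X lam)"
  have "reduced w"
  proof (rule ccontr)
    assume "\<not> reduced w"
    with w obtain q \<alpha> u \<beta> v where "q \<in> star_words \<Omega> X" "\<alpha> \<in> \<Omega>" "\<beta> \<in> \<Omega>" "u \<in> bwords \<Omega> X" "v \<in> bwords \<Omega> X"
      "w = subst_word [Bracket \<alpha> u, Bracket \<beta> v] q"
      using not_reduced_obtain[of w \<Omega> X] by (auto simp: irr_def)
    then have "w = subst_word (lead_mon ord (rb_rel_word lam \<alpha> u \<beta> v)) q" "rb_rel_word lam \<alpha> u \<beta> v \<in> S_M \<Omega> X lam"
      by (auto intro: rb_rel_word_in_S_M simp del: subst_word_simps)
    with w \<open>q \<in> star_words \<Omega> X\<close> show False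
      unfolding irr_def by blast
  qed
  with w show "w \<in> {w \<in> bwords \<Omega> X. reduced w}"
    by (simp add: irr_def)
next
  fix w assume w: "w \<in> {w \<in> bwords \<Omega> X. reduced w}"
  have "w \<noteq> subst_word (lead_mon ord s) q" if "q \<in> star_words \<Omega> X" "s \<in> S_M \<Omega> X lam" for q s
    using w that not_reduced_subst[OF that(1)] by (auto simp: S_M_eq)
  with w show "w \<in> irr \<Omega> X ord (S_M \<Omega> X lam)"
    by (simp add: irr_def)
qed

text \<open>Evaluation multiplies the factors one after another. In a reduced word no junction joins
  two brackets, so each of these products is mere concatenation.\<close>

lemma ev_word_rb_prod_reduced: "reduced w \<Longrightarrow> ev_word (rb_prod_alg lam) (\<lambda>x. mono_elt [Letter x]) w = mono_elt w"
proof (induction w rule: word_induct)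
  case (Bracket \<omega> u w)
  then show ?case
    by (cases rule: words_cases[where u = "[Bracket \<omega> u]" and v = w]) auto
qed simp_all

section \<open>Polynomials supported on reduced words\<close>

definition reduced_polys :: "'w set \<Rightarrow> 'x set \<Rightarrow> ('w, 'x, 'k::comm_ring_1) bpoly set" where
  "reduced_polys \<Omega> X = {f. Poly_Mapping.keys f \<subseteq> {w \<in> bwords \<Omega> X. reduced w}}"

lemma reduced_polys_closed:
  "f \<in> reduced_polys \<Omega> X \<Longrightarrow> g \<in> reduced_polys \<Omega> X \<Longrightarrow> f + g \<in> reduced_polys \<Omega> X"
  "f \<in> reduced_polys \<Omega> X \<Longrightarrow> scale c f \<in> reduced_polys \<Omega> X"
  "\<omega> \<in> \<Omega> \<Longrightarrow> f \<in> reduced_polys \<Omega> X \<Longrightarrow> bracket_lin \<omega> f \<in> reduced_polys \<Omega> X"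
  "0 \<in> reduced_polys \<Omega> X" "w \<in> bwords \<Omega> X \<Longrightarrow> reduced w \<Longrightarrow> Poly_Mapping.single w c \<in> reduced_polys \<Omega> X"
  unfolding reduced_polys_def using keys_scale[of c f] keys_bracket_lin[of f "{w \<in> bwords \<Omega> X. reduced w}" \<omega>]
  by (auto simp: keys_add_subset)

lemma reduced_polys_subset: "reduced_polys \<Omega> X \<subseteq> bpolys \<Omega> X"
  by (auto simp: reduced_polys_def bpolys_def)

lemma reduced_polys_induct [consumes 1, case_names zero single add]:
  assumes "f \<in> reduced_polys \<Omega> X" "P 0" "\<And>w c. w \<in> bwords \<Omega> X \<Longrightarrow> reduced w \<Longrightarrow> P (Poly_Mapping.single w c)"
    and "\<And>f g. f \<in> reduced_polys \<Omega> X \<Longrightarrow> g \<in> reduced_polys \<Omega> X \<Longrightarrow> P f \<Longrightarrow> P g \<Longrightarrow> P (f + g)"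
  shows "P f"
  using assms unfolding reduced_polys_def
  by (intro poly_mapping_keys_induct[of f "{w \<in> bwords \<Omega> X. reduced w}" P]) auto

lemma rb_prod_in_reduced_polys:
  fixes u v :: "('w, 'x) word" and lam :: "'w \<Rightarrow> 'k::comm_ring_1"
  shows "u \<in> bwords \<Omega> X \<Longrightarrow> v \<in> bwords \<Omega> X \<Longrightarrow> reduced u \<Longrightarrow> reduced v \<Longrightarrow> rb_prod lam u v \<in> reduced_polys \<Omega> X"
proof (induction "deg_word u + deg_word v" arbitrary: u v rule: less_induct)
  case less
  show ?case
  proof (cases rule: words_cases[where u = u and v = v])
    case (Brackets u' \<alpha> a \<beta> b v')
    \<comment> \<open>As \<open>u\<close> and \<open>v\<close> are reduced, \<open>u'\<close> does
      not end and \<open>v'\<close> does not begin with a bracket. Putting one bracket in place of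
      the two at the junction therefore creates no new adjacent pair.\<close>
    have sandwich: "mono_elt u' * bracket_lin \<omega> f * mono_elt v' \<in> reduced_polys \<Omega> X"
      if "f \<in> reduced_polys \<Omega> X" "\<omega> \<in> \<Omega>" for f :: "('w, 'x, 'k) bpoly" and \<omega>
      using that
    proof (induction rule: reduced_polys_induct)
      case (single w c)
      then show ?case
        using less.prems that(2) Brackets
        by (auto simp: mult_single plus_list_def reduced_append intro!: reduced_polys_closed)
    qed (simp_all add: bracket_lin_simps distrib_left distrib_right reduced_polys_closed)
    have "rb_prod lam [Bracket \<alpha> a] b \<in> reduced_polys \<Omega> X" "rb_prod lam a [Bracket \<beta> b] \<in> reduced_polys \<Omega> X"
      "rb_prod lam a b \<in> reduced_polys \<Omega> X"
      using less.prems by (auto simp: Brackets reduced_append intro!: less.hyps)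
    then show ?thesis
      using sandwich less.prems
      by (simp add: Brackets rb_prod_Bracket distrib_left distrib_right scale_mult reduced_polys_closed)
  qed (use less.prems in \<open>auto intro!: reduced_polys_closed simp: reduced_append\<close>)
qed

lemma rb_prod_lin_in_reduced_polys:
  assumes "f \<in> reduced_polys \<Omega> X" "g \<in> reduced_polys \<Omega> X"
  shows "rb_prod_lin lam f g \<in> reduced_polys \<Omega> X"
  using assms(1)
proof (induction rule: reduced_polys_induct)
  case (single u c)
  show ?case
    using assms(2) single
    by (induction rule: reduced_polys_induct) (simp_all add: rb_prod_lin_simps rb_prod_lin_single reduced_polys_closed rb_prod_in_reduced_polys)
qed (simp_all add: rb_prod_lin_simps reduced_polys_closed)

lemma ev_poly_rb_prod_reduced:
  assumes "f \<in> reduced_polys \<Omega> X"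
  shows "ev_poly (rb_prod_alg lam) (\<lambda>x. mono_elt [Letter x]) f = f"
proof -
  interpret op_alg \<Omega> "rb_prod_alg lam"
    using matching_rb_prod_alg by unfold_locales (auto simp: matching_rota_baxter_def)
  have letters: "(\<lambda>x. mono_elt [Letter x]) \<in> X \<rightarrow> carrier (rb_prod_alg lam)"
    by simp
  show ?thesis
    using assms
  proof (induction rule: reduced_polys_induct)
    case (add f g)
    then have "f \<in> bpolys \<Omega> X" "g \<in> bpolys \<Omega> X"
      using reduced_polys_subset by blast+
    with add show ?case
      by (simp add: ev_poly_add[OF letters])
  qed (simp_all add: ev_poly_zero[OF letters] ev_poly_single[OF letters] ev_word_rb_prod_reduced)
qed

section \<open>The free matching Rota-Baxter algebra\<close>

lemma operated_hom_compose:
  assumes "f \<in> operated_hom \<Omega> A B" "g \<in> operated_hom \<Omega> B C"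
  shows "(\<lambda>a. g (f a)) \<in> operated_hom \<Omega> A C"
proof -
  have f: "f \<in> ring_hom A B" and g: "g \<in> ring_hom B C"
    using assms by (simp_all add: operated_hom_def)
  have "(\<lambda>a. g (f a)) \<in> ring_hom A C"
    using ring_hom_trans[OF f g] by (simp add: comp_def)
  then show ?thesis
    using assms ring_hom_closed[OF f] by (simp add: operated_hom_def)
qed

lemma S_M_subset_bpolys: "S_M \<Omega> X lam \<subseteq> bpolys \<Omega> X"
  by (auto simp: S_M_eq rb_rel_def intro!: bpolys_closed)

section \<open>The quotient by the Rota-Baxter ideal and its universal property\<close>

locale rb_quotient =
  fixes X :: "'x set" and \<Omega> :: "'w set" and lam :: "'w \<Rightarrow> 'k::comm_ring_1"
begin

abbreviation A :: "('k, ('w, 'x, 'k) bpoly, 'w) operated_alg" where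
  "A \<equiv> bword_alg \<Omega> X"

abbreviation I :: "('w, 'x, 'k) bpoly set" where
  "I \<equiv> gen_operated_ideal \<Omega> A (S_M \<Omega> X lam)"

sublocale alg: op_alg \<Omega> A
  by unfold_locales (rule operated_bword_alg)

sublocale quo: op_ideal \<Omega> A I
  by unfold_locales (simp add: alg.gen_operated_ideal S_M_subset_bpolys)

lemma minus_bword_alg: "f \<in> bpolys \<Omega> X \<Longrightarrow> g \<in> bpolys \<Omega> X \<Longrightarrow> f \<ominus>\<^bsub>A\<^esub> g = f - g"
  using bpolys_closed(4)[OF bpolys_closed(1), of g \<Omega> X] alg.minus_equality[of "- g" g]
  by (simp add: a_minus_def)

lemma ideal_closed:
  "f \<in> I \<Longrightarrow> g \<in> I \<Longrightarrow> f + g \<in> I"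
  "f \<in> I \<Longrightarrow> scale c f \<in> I"
  "f \<in> I \<Longrightarrow> g \<in> bpolys \<Omega> X \<Longrightarrow> g * f \<in> I"
  "f \<in> I \<Longrightarrow> g \<in> bpolys \<Omega> X \<Longrightarrow> f * g \<in> I"
  "\<omega> \<in> \<Omega> \<Longrightarrow> f \<in> I \<Longrightarrow> bracket_lin \<omega> f \<in> I"
  "0 \<in> I"
  using quo.a_closed[of f g] quo.smult_in_ideal[of f c] quo.I_l_closed[of f g]
    quo.I_r_closed[of f g] quo.oper_in_ideal[of \<omega> f] quo.zero_closed
  by simp_all

text \<open>The generators are relations at words only; bilinearity extends them to polynomials,
  since the identity in the quotient concerns arbitrary representatives.\<close>

lemma rb_rel_in_ideal:
  assumes "f \<in> bpolys \<Omega> X" "g \<in> bpolys \<Omega> X" "\<alpha> \<in> \<Omega>" "\<beta> \<in> \<Omega>"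
  shows "rb_rel lam \<alpha> f \<beta> g \<in> I"
proof -
  have zero: "rb_rel lam \<alpha> 0 \<beta> g = 0" "rb_rel lam \<alpha> f \<beta> 0 = 0" for f g :: "('w, 'x, 'k) bpoly"
    by (simp_all add: rb_rel_def bracket_lin_simps scale_simps)
  show ?thesis
    using assms(1)
  proof (induction rule: bpolys_induct)
    case (single u c)
    show ?case
      using assms(2)
    proof (induction rule: bpolys_induct)
      case (single v d)
      have "rb_rel_word lam \<alpha> u \<beta> v \<in> I"
        using alg.gen_operated_ideal(2)[of "S_M \<Omega> X lam"] S_M_subset_bpolys rb_rel_word_in_S_M single
          \<open>u \<in> bwords \<Omega> X\<close> assms(3,4) by fastforce
      then show ?case
        unfolding single_eq_scale[of u c] single_eq_scale[of v d] rb_rel_simps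
        by (intro ideal_closed)
    qed (simp_all add: zero rb_rel_simps ideal_closed)
  qed (simp_all add: zero rb_rel_simps ideal_closed)
qed

lemma matching_quotient: "matching_rota_baxter \<Omega> lam (quot_alg A I)"
  unfolding matching_rota_baxter_def
proof (intro conjI ballI)
  fix \<alpha> \<beta> C D assume ab: "\<alpha> \<in> \<Omega>" "\<beta> \<in> \<Omega>" and "C \<in> carrier quo.Q" "D \<in> carrier quo.Q"
  then obtain f g where fg: "C = I +>\<^bsub>A\<^esub> f" "f \<in> bpolys \<Omega> X" "D = I +>\<^bsub>A\<^esub> g" "g \<in> bpolys \<Omega> X"
    by (auto simp: quo.carrier_quot)
  have "I +>\<^bsub>A\<^esub> (bracket_lin \<alpha> f * bracket_lin \<beta> g) =
    I +>\<^bsub>A\<^esub> (bracket_lin \<beta> (bracket_lin \<alpha> f * g) + bracket_lin \<alpha> (f * bracket_lin \<beta> g)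
      + scale (lam \<beta>) (bracket_lin \<alpha> (f * g)))"
    using rb_rel_in_ideal[OF fg(2,4) ab] fg ab
    by (subst quo.coset_eq_iff) (simp_all add: bpolys_closed minus_bword_alg rb_rel_def diff_diff_eq add.assoc)
  then show "oper quo.Q \<alpha> C \<otimes>\<^bsub>quo.Q\<^esub> oper quo.Q \<beta> D =
      oper quo.Q \<beta> (oper quo.Q \<alpha> C \<otimes>\<^bsub>quo.Q\<^esub> D) \<oplus>\<^bsub>quo.Q\<^esub> oper quo.Q \<alpha> (C \<otimes>\<^bsub>quo.Q\<^esub> oper quo.Q \<beta> D)
      \<oplus>\<^bsub>quo.Q\<^esub> lam \<beta> \<odot>\<^bsub>quo.Q\<^esub> oper quo.Q \<alpha> (C \<otimes>\<^bsub>quo.Q\<^esub> D)"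
    using fg ab by (simp add: quo.quot_simps bpolys_closed)
qed (rule quo.operated_quot)

text \<open>The kernel of evaluation is an operated ideal, and it contains the generators because
  the identity holds in \<open>B\<close>. Arbitrary \<open>B\<close> gives existence in the
  universal property, and \<open>B\<close> = \<open>rb_prod_alg lam\<close> gives
  independence.\<close>

lemma ev_poly_kills_ideal:
  assumes B: "matching_rota_baxter \<Omega> lam B" and f: "f \<in> X \<rightarrow> carrier B" and "p \<in> I"
  shows "ev_poly B f p = \<zero>\<^bsub>B\<^esub>"
proof -
  interpret B: op_alg \<Omega> B
    using B by unfold_locales (simp add: matching_rota_baxter_def)
  note ev = B.ev_poly_closed[OF f] B.ev_poly_add[OF f] B.ev_poly_mult[OF f] B.ev_poly_scale[OF f]
    B.ev_poly_bracket[OF f]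
  let ?K = "a_kernel A B (ev_poly B f)"
  have "ev_poly B f \<in> ring_hom A B"
    using B.ev_poly_hom[OF f] unfolding operated_hom_def by blast
  then have "ideal ?K A"
    by (intro ring_hom_ring.kernel_is_ideal ring_hom_ringI2[OF alg.ring_axioms B.ring_axioms])
  moreover have "bracket_lin \<omega> q \<in> ?K" if "\<omega> \<in> \<Omega>" "q \<in> ?K" for \<omega> q
    using that by (simp add: a_kernel_def' ev(5) bpolys_closed B.oper_zero)
  ultimately have "operated_ideal \<Omega> A ?K"
    unfolding operated_ideal_def bword_alg_simps by blast
  moreover have "S_M \<Omega> X lam \<subseteq> ?K"
  proof
    fix s assume "s \<in> S_M \<Omega> X lam"
    then obtain u v \<alpha> \<beta> where s: "s = rb_rel_word lam \<alpha> u \<beta> v"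
      and uv: "u \<in> bwords \<Omega> X" "v \<in> bwords \<Omega> X" "\<alpha> \<in> \<Omega>" "\<beta> \<in> \<Omega>"
      by (auto simp: S_M_eq)
    define a b where "a = (mono_elt u :: ('w, 'x, 'k) bpoly)" and "b = (mono_elt v :: ('w, 'x, 'k) bpoly)"
    have ab: "a \<in> bpolys \<Omega> X" "b \<in> bpolys \<Omega> X"
      using uv by (simp_all add: a_def b_def bpolys_closed)
    \<comment> \<open>Moving the negative terms across gives product = \<open>s + ?r\<close>. The
      product and \<open>?r\<close> have the same value in \<open>B\<close>, so cancellation there
      makes the value of \<open>s\<close> zero.\<close>
    let ?r = "bracket_lin \<beta> (bracket_lin \<alpha> a * b) + bracket_lin \<alpha> (a * bracket_lin \<beta> b)
      + scale (lam \<beta>) (bracket_lin \<alpha> (a * b))"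
    have r: "?r \<in> bpolys \<Omega> X"
      using ab uv by (intro bpolys_closed)
    have "ev_poly B f (bracket_lin \<alpha> a * bracket_lin \<beta> b) = ev_poly B f ?r"
      using B ab uv by (simp add: ev bpolys_closed matching_rota_baxter_def)
    moreover have "bracket_lin \<alpha> a * bracket_lin \<beta> b = s + ?r"
      by (simp add: s rb_rel_def a_def b_def)
    moreover have "s \<in> bpolys \<Omega> X"
      using S_M_subset_bpolys \<open>s \<in> S_M \<Omega> X lam\<close> by blast
    ultimately have "ev_poly B f s = \<zero>\<^bsub>B\<^esub>"
      using ev(2)[OF _ r, of s] ev(1)[of s] ev(1)[OF r] by simp
    with \<open>s \<in> bpolys \<Omega> X\<close> show "s \<in> ?K"
      by (simp add: a_kernel_def')
  qed
  ultimately have "I \<subseteq> ?K"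
    by (auto simp: gen_operated_ideal_def)
  with \<open>p \<in> I\<close> show ?thesis
    by (auto simp: a_kernel_def')
qed

lemma free_quotient:
  "free_matching_rota_baxter TYPE('b) \<Omega> lam X (quot_alg A I) (\<lambda>x. I +>\<^bsub>A\<^esub> mono_elt [Letter x])"
  unfolding free_matching_rota_baxter_def
proof (intro conjI allI impI)
  show "(\<lambda>x. I +>\<^bsub>A\<^esub> mono_elt [Letter x]) \<in> X \<rightarrow> carrier quo.Q"
    by (auto simp: bpolys_closed)
next
  fix B :: "('k, 'b, 'w) operated_alg" and f
  assume B: "matching_rota_baxter \<Omega> lam B" and f: "f \<in> X \<rightarrow> carrier B"
  interpret B: op_alg \<Omega> B
    using B by unfold_locales (simp add: matching_rota_baxter_def)
  have letter: "ev_poly B f (mono_elt [Letter x]) = f x" if "x \<in> X" for x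
    using Pi_mem[OF f that] that by (simp add: B.ev_poly_single[OF f] B.smult_1)
  obtain \<phi> where \<phi>: "\<phi> \<in> operated_hom \<Omega> quo.Q B" "\<phi> \<in> extensional (carrier quo.Q)"
    "\<And>p. p \<in> carrier A \<Longrightarrow> \<phi> (I +>\<^bsub>A\<^esub> p) = ev_poly B f p"
    using quo.hom_factors[OF B.ev_poly_hom[OF f] B.op_alg_axioms ev_poly_kills_ideal[OF B f]] by blast
  show "\<exists>!\<phi>. \<phi> \<in> extensional (carrier quo.Q) \<and> \<phi> \<in> operated_hom \<Omega> quo.Q B \<and>
      (\<forall>x\<in>X. \<phi> (I +>\<^bsub>A\<^esub> mono_elt [Letter x]) = f x)"
  proof (rule ex1I)
    show "\<phi> \<in> extensional (carrier quo.Q) \<and> \<phi> \<in> operated_hom \<Omega> quo.Q B \<and>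
      (\<forall>x\<in>X. \<phi> (I +>\<^bsub>A\<^esub> mono_elt [Letter x]) = f x)"
      using \<phi> by (simp add: bpolys_closed letter)
  next
    fix \<psi> assume \<psi>: "\<psi> \<in> extensional (carrier quo.Q) \<and> \<psi> \<in> operated_hom \<Omega> quo.Q B \<and>
      (\<forall>x\<in>X. \<psi> (I +>\<^bsub>A\<^esub> mono_elt [Letter x]) = f x)"
    \<comment> \<open>Composed with the projection, a competing map is a homomorphism out of
      \<open>bword_alg\<close> and hence determined by the letters. The projection is onto, and both
      maps are extensional.\<close>
    have "(\<lambda>p. \<psi> (I +>\<^bsub>A\<^esub> p)) \<in> operated_hom \<Omega> A B"
      using \<psi> operated_hom_compose[OF quo.quot_hom] by blast
    then have "\<psi> (I +>\<^bsub>A\<^esub> p) = ev_poly B f p" if "p \<in> bpolys \<Omega> X" for p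
      using B.operated_hom_eq_ev_poly[of "\<lambda>p. \<psi> (I +>\<^bsub>A\<^esub> p)" X f p] \<psi> that by simp
    then show "\<psi> = \<phi>"
      using \<psi> \<phi>(2,3) by (intro extensionalityI[of _ "carrier quo.Q"]) (auto simp: quo.carrier_quot)
  qed
qed (rule matching_quotient)

section \<open>Spanning by reduction modulo the ideal\<close>

lemma rb_prod_congruent:
  "u \<in> bwords \<Omega> X \<Longrightarrow> v \<in> bwords \<Omega> X \<Longrightarrow> mono_elt (u @ v) - rb_prod lam u v \<in> I"
proof (induction "deg_word u + deg_word v" arbitrary: u v rule: less_induct)
  case less
  show ?case
  proof (cases rule: words_cases[where u = u and v = v])
    case (Brackets u' \<alpha> a \<beta> b v')
    have bw: "u' \<in> bwords \<Omega> X" "\<alpha> \<in> \<Omega>" "a \<in> bwords \<Omega> X" "\<beta> \<in> \<Omega>" "b \<in> bwords \<Omega> X" "v' \<in> bwords \<Omega> X"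
      using less.prems by (simp_all add: Brackets)
    have IH: "mono_elt (Bracket \<alpha> a # b) - rb_prod lam [Bracket \<alpha> a] b \<in> I"
      "mono_elt (a @ [Bracket \<beta> b]) - rb_prod lam a [Bracket \<beta> b] \<in> I" "mono_elt (a @ b) - rb_prod lam a b \<in> I"
      using less.hyps[of "[Bracket \<alpha> a]" b] less.hyps[of a "[Bracket \<beta> b]"] less.hyps[of a b] bw
      by (simp_all add: Brackets)
    \<comment> \<open>The relation trades the product of two brackets for three bracketed words, and
      each further summand trades the argument of one of these for a \<diamond>-product. The
      intermediate words cancel in the sum.\<close>
    let ?d = "rb_rel_word lam \<alpha> a \<beta> b + bracket_lin \<beta> (mono_elt (Bracket \<alpha> a # b) - rb_prod lam [Bracket \<alpha> a] b)
      + bracket_lin \<alpha> (mono_elt (a @ [Bracket \<beta> b]) - rb_prod lam a [Bracket \<beta> b])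
      + scale (lam \<beta>) (bracket_lin \<alpha> (mono_elt (a @ b) - rb_prod lam a b))"
    have "?d \<in> I"
      using bw IH by (intro ideal_closed rb_rel_in_ideal) (simp_all add: bpolys_closed)
    then have "mono_elt u' * ?d * mono_elt v' \<in> I"
      using bw by (intro ideal_closed(4)[OF ideal_closed(3)] bpolys_closed)
    also have "?d = mono_elt [Bracket \<alpha> a, Bracket \<beta> b] - (bracket_lin \<beta> (rb_prod lam [Bracket \<alpha> a] b)
      + bracket_lin \<alpha> (rb_prod lam a [Bracket \<beta> b]) + scale (lam \<beta>) (bracket_lin \<alpha> (rb_prod lam a b)))"
      by (simp add: rb_rel_word_eq bracket_lin_simps scale_simps)
    also have "mono_elt u' * \<dots> * mono_elt v' = mono_elt (u @ v) - rb_prod lam u v"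
      by (simp add: Brackets rb_prod_Bracket right_diff_distrib left_diff_distrib mono_elt_mult)
    finally show ?thesis .
  qed (simp_all add: ideal_closed)
qed

lemma rb_prod_lin_congruent:
  assumes "f \<in> bpolys \<Omega> X" "g \<in> bpolys \<Omega> X"
  shows "f * g - rb_prod_lin lam f g \<in> I"
  using assms(1)
proof (induction rule: bpolys_induct)
  case (single u c)
  show ?case
    using assms(2)
  proof (induction rule: bpolys_induct)
    case (single v d)
    have "scale (c * d) (mono_elt (u @ v) - rb_prod lam u v) \<in> I"
      using single \<open>u \<in> bwords \<Omega> X\<close> by (intro ideal_closed rb_prod_congruent)
    then show ?case
      by (simp add: scale_simps mult_single plus_list_def rb_prod_lin_single)
  next
    case (add f g)
    then show ?case
      using ideal_closed(1)[OF add(3,4)] by (simp add: rb_prod_lin_simps distrib_left algebra_simps)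
  qed (simp add: rb_prod_lin_simps ideal_closed)
next
  case (add f h)
  then show ?case
    using ideal_closed(1)[OF add(3,4)] by (simp add: rb_prod_lin_simps distrib_right algebra_simps)
qed (simp add: rb_prod_lin_simps ideal_closed)

lemma word_reduces:
  "w \<in> bwords \<Omega> X \<Longrightarrow> \<exists>f\<in>reduced_polys \<Omega> X. mono_elt w - f \<in> I"
proof (induction w rule: word_induct)
  case Nil
  show ?case
    by (intro bexI[of _ "mono_elt []"]) (simp_all add: ideal_closed reduced_polys_closed del: mono_elt_Nil)
next
  case (Letter x w)
  then obtain f where f: "f \<in> reduced_polys \<Omega> X" "mono_elt w - f \<in> I"
    by auto
  \<comment> \<open>A letter multiplies by plain concatenation; writing that product as \<diamond>
    makes the closure of \<open>reduced_polys\<close> applicable.\<close>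
  have "rb_prod_lin lam (mono_elt [Letter x]) f \<in> reduced_polys \<Omega> X"
    using f Letter.prems by (intro rb_prod_lin_in_reduced_polys reduced_polys_closed) simp_all
  moreover have "mono_elt [Letter x] * (mono_elt w - f) \<in> I"
    using f Letter.prems by (intro ideal_closed bpolys_closed) simp_all
  ultimately show ?case
    by (intro bexI[of _ "rb_prod_lin lam (mono_elt [Letter x]) f"])
      (simp_all add: rb_prod_lin_Letter right_diff_distrib mono_elt_mult)
next
  case (Bracket \<omega> u w)
  then obtain f g where fg: "f \<in> reduced_polys \<Omega> X" "mono_elt u - f \<in> I" "g \<in> reduced_polys \<Omega> X" "mono_elt w - g \<in> I"
    by auto
  have bp: "f \<in> bpolys \<Omega> X" "g \<in> bpolys \<Omega> X"
    using fg reduced_polys_subset by blast+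
  have "rb_prod_lin lam (bracket_lin \<omega> f) g \<in> reduced_polys \<Omega> X"
    using fg Bracket.prems by (intro rb_prod_lin_in_reduced_polys reduced_polys_closed) simp_all
  \<comment> \<open>Telescoping: the argument of the bracket is replaced by \<open>f\<close>, then
    the remaining word by \<open>g\<close>, then the ordinary product by \<diamond>.\<close>
  moreover have "bracket_lin \<omega> (mono_elt u - f) * mono_elt w + bracket_lin \<omega> f * (mono_elt w - g)
      + (bracket_lin \<omega> f * g - rb_prod_lin lam (bracket_lin \<omega> f) g) \<in> I"
  proof (intro ideal_closed(1))
    show "bracket_lin \<omega> (mono_elt u - f) * mono_elt w \<in> I"
      using fg Bracket.prems by (intro ideal_closed(4,5) bpolys_closed) simp_all
    show "bracket_lin \<omega> f * (mono_elt w - g) \<in> I"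
      using fg bp Bracket.prems by (intro ideal_closed(3) bpolys_closed) simp_all
    show "bracket_lin \<omega> f * g - rb_prod_lin lam (bracket_lin \<omega> f) g \<in> I"
      using bp Bracket.prems by (intro rb_prod_lin_congruent bpolys_closed) simp_all
  qed
  ultimately show ?case
    by (intro bexI[of _ "rb_prod_lin lam (bracket_lin \<omega> f) g"])
      (simp_all add: bracket_lin_simps left_diff_distrib right_diff_distrib mono_elt_mult)
qed

lemma reduces:
  assumes "p \<in> bpolys \<Omega> X"
  shows "\<exists>f\<in>reduced_polys \<Omega> X. p - f \<in> I"
  using assms
proof (induction rule: bpolys_induct)
  case (single w c)
  then obtain f where "f \<in> reduced_polys \<Omega> X" "mono_elt w - f \<in> I"
    using word_reduces by blast
  then show ?case
    using ideal_closed(2)[of "mono_elt w - f" c]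
    by (intro bexI[of _ "scale c f"]) (simp_all add: scale_simps reduced_polys_closed)
next
  case (add p q)
  then obtain f g where "f \<in> reduced_polys \<Omega> X" "p - f \<in> I" "g \<in> reduced_polys \<Omega> X" "q - g \<in> I"
    by blast
  then show ?case
    using ideal_closed(1)[of "p - f" "q - g"]
    by (intro bexI[of _ "f + g"]) (simp_all add: reduced_polys_closed algebra_simps)
qed (auto intro: bexI[of _ 0] simp: ideal_closed reduced_polys_closed)

lemma finsum_bword_alg:
  assumes "finite F" "F \<subseteq> bwords \<Omega> X"
  shows "(\<Oplus>\<^bsub>A\<^esub>w\<in>F. Poly_Mapping.single w (c w)) = (\<Sum>w\<in>F. Poly_Mapping.single w (c w))"
  using assms
proof (induction F)
  case (insert w F)
  then have "(\<lambda>w. Poly_Mapping.single w (c w)) \<in> F \<rightarrow> bpolys \<Omega> X" "Poly_Mapping.single w (c w) \<in> bpolys \<Omega> X"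
    by (auto simp: bpolys_closed)
  with insert show ?case
    by simp
qed simp

lemma finsum_quotient:
  assumes "finite F" "F \<subseteq> bwords \<Omega> X"
  shows "(\<Oplus>\<^bsub>quo.Q\<^esub>w\<in>F. c w \<odot>\<^bsub>quo.Q\<^esub> (I +>\<^bsub>A\<^esub> mono_elt w)) =
    I +>\<^bsub>A\<^esub> (\<Sum>w\<in>F. Poly_Mapping.single w (c w))"
proof -
  have "(\<Oplus>\<^bsub>quo.Q\<^esub>w\<in>F. c w \<odot>\<^bsub>quo.Q\<^esub> (I +>\<^bsub>A\<^esub> mono_elt w)) =
    (\<Oplus>\<^bsub>quo.Q\<^esub>w\<in>F. I +>\<^bsub>A\<^esub> Poly_Mapping.single w (c w))"
  proof (rule quo.quot.finsum_cong')
    show "(\<lambda>w. I +>\<^bsub>A\<^esub> Poly_Mapping.single w (c w)) \<in> F \<rightarrow> carrier quo.Q"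
      using assms by (auto simp: bpolys_closed)
    show "c w \<odot>\<^bsub>quo.Q\<^esub> (I +>\<^bsub>A\<^esub> mono_elt w) = I +>\<^bsub>A\<^esub> Poly_Mapping.single w (c w)" if "w \<in> F" for w
      using assms that by (subst quo.quot_simps) (auto simp: bpolys_closed)
  qed simp
  also have "\<dots> = I +>\<^bsub>A\<^esub> (\<Oplus>\<^bsub>A\<^esub>w\<in>F. Poly_Mapping.single w (c w))"
    using assms by (intro quo.finsum_coset) (auto simp: bpolys_closed)
  finally show ?thesis
    by (simp add: finsum_bword_alg assms)
qed

lemma basis_quotient:
  "basis_family (quot_alg A I) {w \<in> bwords \<Omega> X. reduced w} (\<lambda>w. I +>\<^bsub>A\<^esub> mono_elt w)"
  unfolding basis_family_def
proof (intro conjI allI impI ballI)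
  show "(\<lambda>w. I +>\<^bsub>A\<^esub> mono_elt w) \<in> {w \<in> bwords \<Omega> X. reduced w} \<rightarrow> carrier quo.Q"
    by (auto simp: bpolys_closed)
next
  fix F c w
  assume F: "finite F" "F \<subseteq> {w \<in> bwords \<Omega> X. reduced w}" "w \<in> F"
    and sum: "(\<Oplus>\<^bsub>quo.Q\<^esub>w\<in>F. c w \<odot>\<^bsub>quo.Q\<^esub> (I +>\<^bsub>A\<^esub> mono_elt w)) = \<zero>\<^bsub>quo.Q\<^esub>"
  define p where "p = (\<Sum>w\<in>F. Poly_Mapping.single w (c w))"
  have p: "p \<in> reduced_polys \<Omega> X"
    unfolding p_def using F(1,2) by (induction F) (auto intro!: reduced_polys_closed)
  have "I +>\<^bsub>A\<^esub> p = I"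
    using finsum_quotient[of F c] F(1,2) sum by (auto simp: p_def quo.quot_simps)
  then have "p \<in> I"
    using p reduced_polys_subset quo.coset_eq_I[of p] by auto
  then have "p = 0"
    using ev_poly_kills_ideal[OF matching_rb_prod_alg, of "\<lambda>x. mono_elt [Letter x]" p] ev_poly_rb_prod_reduced[OF p, of lam]
    by simp
  moreover have "Poly_Mapping.lookup p w = c w"
    using F by (simp add: p_def lookup_sum lookup_single when_def)
  ultimately show "c w = 0"
    by simp
next
  fix C assume "C \<in> carrier quo.Q"
  then obtain p where p: "C = I +>\<^bsub>A\<^esub> p" "p \<in> bpolys \<Omega> X"
    by (auto simp: quo.carrier_quot)
  then obtain f where f: "f \<in> reduced_polys \<Omega> X" "p - f \<in> I"
    using reduces by blast
  let ?F = "Poly_Mapping.keys f"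
  have "f \<in> bpolys \<Omega> X"
    using f reduced_polys_subset by blast
  with p f have "C = I +>\<^bsub>A\<^esub> f"
    using quo.coset_eq_iff[of p f] by (simp add: minus_bword_alg)
  also have "\<dots> = (\<Oplus>\<^bsub>quo.Q\<^esub>w\<in>?F. Poly_Mapping.lookup f w \<odot>\<^bsub>quo.Q\<^esub> (I +>\<^bsub>A\<^esub> mono_elt w))"
    using finsum_quotient[of ?F "Poly_Mapping.lookup f"] \<open>f \<in> bpolys \<Omega> X\<close>
      poly_mapping_eq_sum_single[of f] by (simp add: bpolys_def)
  finally show "\<exists>F c. finite F \<and> F \<subseteq> {w \<in> bwords \<Omega> X. reduced w} \<and>
      C = (\<Oplus>\<^bsub>quo.Q\<^esub>w\<in>F. c w \<odot>\<^bsub>quo.Q\<^esub> (I +>\<^bsub>A\<^esub> mono_elt w))"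
    using f(1) by (intro exI[of _ ?F] exI[of _ "Poly_Mapping.lookup f"]) (auto simp: reduced_polys_def)
qed

end

theorem proposition3p14:
  fixes X :: "'x set" and \<Omega> :: "'w set" and lam :: "'w \<Rightarrow> 'k::comm_ring_1"
    and rX :: "'x rel" and rO :: "'w rel"
  defines "ord \<equiv> db_order \<Omega> X rO rX"
    and "A \<equiv> (bword_alg \<Omega> X :: ('k, ('w, 'x, 'k) bpoly, 'w) operated_alg)"
  defines "I \<equiv> gen_operated_ideal \<Omega> A (S_M \<Omega> X lam)"
  assumes "\<Omega> \<noteq> {}"
    and "well_order_on X rX"
    and "well_order_on \<Omega> rO"
  shows "monomial_order \<Omega> X ord \<and>
    groebner_shirshov_basis \<Omega> X ord (S_M \<Omega> X lam) \<and>
    free_matching_rota_baxter TYPE('b) \<Omega> lam X (quot_alg A I)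
      (\<lambda>x. I +>\<^bsub>A\<^esub> mono_elt [Letter x]) \<and>
    basis_family (quot_alg A I) (irr \<Omega> X ord (S_M \<Omega> X lam)) (\<lambda>w. I +>\<^bsub>A\<^esub> mono_elt w)"
proof -
  interpret db_ordered X \<Omega> lam rX rO
    using assms by unfold_locales
  show ?thesis
    unfolding ord_def A_def I_def irr_eq_reduced
    using monomial_db_order[OF wo_X wo_O] groebner_shirshov_S_M
      rb_quotient.free_quotient rb_quotient.basis_quotient by blast
qed

end
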